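(* There exists an absolute constant $c_0>0$ such that for every $n\ge 1$ and every set of functions $\{f_i\}_{i=1}^n\subset L_1[0,1]$ with $\|f_i\|_1=1$ for all $i$, there exists a sequence of signs $\{\theta_i\}_{i=1}^n$, $\theta_i=\pm1$, such that $$\sup_{\Delta\subset[0,1],\ \mu\Delta=2^{-k}}\Big\{2^k\int_\Delta\Big|\sum_{i=1}^n\theta_i f_i(x)\Big|\,d\mu(x)\Big\}\ \ge\ c_0\sqrt{nk}$$ for all $k=1,\dots,[\log n]$.
   Context: $\mu$ is Lebesgue measure on $[0,1]$; the supremum is over measurable sets $\Delta$ of measure exactly $2^{-k}$. $[\,\cdot\,]$ denotes the integer part and $\log$ the natural logarithm. The signs $\theta_i$ may depend on the functions but not on $k$. *)

theory Defs
  imports "HOL-Analysis.Analysis"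
begin

abbreviation mu :: "real measure" where
  "mu \<equiv> lebesgue_on {0..1}"

end

theory Submission
  imports Defs "HOL-Probability.Probability_Measure" "HOL-Real_Asymp.Real_Asymp"
begin

text \<open>
  Let \<open>\<phi> = (\<Sum>i. \<bar>f i\<bar>) / n\<close>, \<open>a i = f i / \<phi>\<close> and pass to the probability measure \<open>N = \<phi> dx\<close>. Every point then
  has \<open>\<Sum>i. \<bar>a i x\<bar> = n\<close>, and every \<open>a i\<close> has \<open>L\<^sub>1\<close> norm 1. If some signs give
  \<open>A \<theta> = \<Sum>i. \<theta> i * a i\<close> an \<open>L\<^sub>1\<close> norm above \<open>sqrt (n ln n)\<close>, these signs serve all levels at once.
  Otherwise take random signs, and let \<open>M \<ge> sqrt n\<close> be the mean of the pointwise \<open>\<ell>\<^sub>2\<close> norm of \<open>a\<close>.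
  With probability at least 3/32 the \<open>L\<^sub>1\<close> norm of \<open>A \<theta>\<close> is at least \<open>M / 4\<close>, which serves all levels
  up to a large multiple of \<open>M\<^sup>2 / n\<close>. A higher level \<open>k\<close> fails with probability \<open>O(M\<^sup>2 / (n k)) + n\<^sup>-\<^sup>c\<close>, and
  these probabilities have a small sum over a geometric progression of levels, which suffices because the
  supremum increases with \<open>k\<close>.

  For the last estimate, tilt the law of the signs at \<open>x\<close> towards the part of \<open>a\<close> bounded by \<open>n powr (1/4)\<close>,
  so that \<open>A \<theta> x\<close> has mean of order \<open>sqrt (n k)\<close>. The average over \<open>x\<close> of the densities of the tilted laws is
  close to 1 in \<open>L\<^sub>2\<close>: two tilts at \<open>x\<close> and \<open>y\<close> are nearly orthogonal for most pairs, since no signs have a large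
  \<open>L\<^sub>1\<close> norm and every \<open>a i\<close> has norm 1. Each density is at most \<open>exp (k / 4)\<close> on the good event, so the
  set where \<open>A \<theta>\<close> is large has measure at least \<open>2\<^sup>-\<^sup>k / 2\<close>.
\<close>

subsection \<open>Random signs\<close>

definition signs :: "'i set \<Rightarrow> ('i \<Rightarrow> real) set" where
  "signs I = PiE I (\<lambda>_. {-1, 1})"

text \<open>The mean of \<open>g\<close> under independent signs with means \<open>p i\<close>. The
  weights form a probability law when every \<open>\<bar>p i\<bar>\<close> is at most 1, and
  \<open>p = 0\<close> gives uniform signs.\<close>

definition sign_expect :: "'i set \<Rightarrow> ('i \<Rightarrow> real) \<Rightarrow> (('i \<Rightarrow> real) \<Rightarrow> real) \<Rightarrow> real" where
  "sign_expect I p g = (\<Sum>\<theta>\<in>signs I. (\<Prod>i\<in>I. (1 + p i * \<theta> i) / 2) * g \<theta>)"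

lemma finite_signs: "finite I \<Longrightarrow> finite (signs I)"
  by (simp add: signs_def finite_PiE)

lemma signs_cases: "\<theta> \<in> signs I \<Longrightarrow> i \<in> I \<Longrightarrow> \<theta> i = 1 \<or> \<theta> i = -1"
  by (auto simp: signs_def PiE_iff)

lemma signs_weight_nonneg:
  assumes "\<theta> \<in> signs I" "\<And>i. i \<in> I \<Longrightarrow> \<bar>p i\<bar> \<le> 1"
  shows "0 \<le> (\<Prod>i\<in>I. 1 + p i * \<theta> i)"
proof (rule prod_nonneg)
  fix i assume "i \<in> I"
  then show "0 \<le> 1 + p i * \<theta> i"
    using signs_cases[OF assms(1), of i] assms(2)[of i] by auto
qed

lemma sign_expect_cong:
  "(\<And>\<theta>. \<theta> \<in> signs I \<Longrightarrow> g \<theta> = h \<theta>) \<Longrightarrow> sign_expect I p g = sign_expect I p h"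
  by (simp add: sign_expect_def)

lemma sign_expect_add: "sign_expect I p (\<lambda>\<theta>. g \<theta> + h \<theta>) = sign_expect I p g + sign_expect I p h"
  by (simp add: sign_expect_def sum.distrib distrib_left)

lemma sign_expect_diff: "sign_expect I p (\<lambda>\<theta>. g \<theta> - h \<theta>) = sign_expect I p g - sign_expect I p h"
  by (simp add: sign_expect_def sum_subtractf right_diff_distrib)

lemma sign_expect_cmult: "sign_expect I p (\<lambda>\<theta>. c * g \<theta>) = c * sign_expect I p g"
  by (simp add: sign_expect_def sum_distrib_left algebra_simps)

lemma sign_expect_divide: "sign_expect I p (\<lambda>\<theta>. g \<theta> / c) = sign_expect I p g / c"
  by (simp add: sign_expect_def sum_divide_distrib)

lemma sign_expect_sum:
  "sign_expect I p (\<lambda>\<theta>. \<Sum>j\<in>J. g j \<theta>) = (\<Sum>j\<in>J. sign_expect I p (g j))"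
  unfolding sign_expect_def by (simp add: sum_distrib_left) (rule sum.swap)

lemma sign_expect_mono:
  assumes "\<And>i. i \<in> I \<Longrightarrow> \<bar>p i\<bar> \<le> 1" "\<And>\<theta>. \<theta> \<in> signs I \<Longrightarrow> g \<theta> \<le> h \<theta>"
  shows "sign_expect I p g \<le> sign_expect I p h"
  unfolding sign_expect_def
proof (rule sum_mono)
  fix \<theta> assume t: "\<theta> \<in> signs I"
  have "0 \<le> (\<Prod>i\<in>I. (1 + p i * \<theta> i) / 2)"
    using signs_weight_nonneg[OF t assms(1)] by (simp add: prod_dividef)
  then show "(\<Prod>i\<in>I. (1 + p i * \<theta> i) / 2) * g \<theta> \<le> (\<Prod>i\<in>I. (1 + p i * \<theta> i) / 2) * h \<theta>"
    by (rule mult_left_mono[OF assms(2)[OF t]])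
qed

text \<open>Independence of the signs, in the form of the distributive law for a product of two-term
  sums.\<close>

lemma sign_expect_prod:
  assumes "finite I"
  shows "sign_expect I p (\<lambda>\<theta>. \<Prod>i\<in>I. g i (\<theta> i)) =
    (\<Prod>i\<in>I. (1 + p i) / 2 * g i 1 + (1 - p i) / 2 * g i (- 1))"
proof -
  have "sign_expect I p (\<lambda>\<theta>. \<Prod>i\<in>I. g i (\<theta> i)) =
      (\<Sum>\<theta>\<in>PiE I (\<lambda>_. {-1, 1}). \<Prod>i\<in>I. (1 + p i * \<theta> i) / 2 * g i (\<theta> i))"
    by (simp only: sign_expect_def signs_def prod.distrib)
  also have "\<dots> = (\<Prod>i\<in>I. \<Sum>s\<in>{-1, 1}. (1 + p i * s) / 2 * g i s)"
    by (rule prod_sum_PiE[symmetric]) (use assms in auto)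
  finally show ?thesis by (simp add: add.commute)
qed

lemma sign_expect_const: "finite I \<Longrightarrow> sign_expect I p (\<lambda>_. c) = c"
  using sign_expect_cmult[of I p c "\<lambda>_. 1"] sign_expect_prod[of I p "\<lambda>_ _. 1"]
  by (simp add: field_simps)

text \<open>Conditioning on the sign at \<open>j\<close>. The moment computations below add one
  index at a time through it.\<close>

lemma sign_expect_insert:
  assumes "finite I" "j \<notin> I"
  shows "sign_expect (insert j I) p g =
    (1 + p j) / 2 * sign_expect I p (\<lambda>\<theta>. g (\<theta>(j := 1))) +
    (1 - p j) / 2 * sign_expect I p (\<lambda>\<theta>. g (\<theta>(j := -1)))"
proof -
  let ?w = "\<lambda>\<theta>. \<Prod>i\<in>I. (1 + p i * \<theta> i) / 2"
  have w: "(\<Prod>i\<in>I. (1 + p i * (\<theta>(j := s)) i) / 2) = ?w \<theta>" for \<theta> s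
    by (rule prod.cong) (use assms in auto)
  have "sign_expect (insert j I) p g =
      (\<Sum>\<theta>\<in>(\<lambda>(s, \<theta>). \<theta>(j := s)) ` ({-1, 1} \<times> signs I).
        (\<Prod>i\<in>insert j I. (1 + p i * \<theta> i) / 2) * g \<theta>)"
    by (simp add: sign_expect_def signs_def PiE_insert_eq)
  also have "\<dots> = (\<Sum>(s, \<theta>)\<in>{-1, 1} \<times> signs I.
      (\<Prod>i\<in>insert j I. (1 + p i * (\<theta>(j := s)) i) / 2) * g (\<theta>(j := s)))"
    by (subst sum.reindex) (use assms in \<open>auto simp: signs_def split_def intro!: inj_combinator[unfolded split_def]\<close>)
  also have "\<dots> = (\<Sum>s\<in>{-1, 1}. \<Sum>\<theta>\<in>signs I. (1 + p j * s) / 2 * (?w \<theta> * g (\<theta>(j := s))))"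
    using assms by (subst sum.cartesian_product[symmetric], intro sum.cong refl) (simp add: w mult.assoc del: fun_upd_apply, simp)
  finally show ?thesis
    by (simp add: sign_expect_def sum_distrib_left)
qed

section \<open>Moments of sign sums\<close>

lemma sum_fun_upd_notin: "j \<notin> I \<Longrightarrow> (\<Sum>i\<in>I. (\<theta>(j := s)) i * b i) = (\<Sum>i\<in>I. \<theta> i * b i :: real)"
  by (rule sum.cong) auto

lemma sign_expect_linear:
  assumes "finite I"
  shows "sign_expect I p (\<lambda>\<theta>. \<Sum>i\<in>I. \<theta> i * b i) = (\<Sum>i\<in>I. p i * b i)"
  using assms
proof (induction I)
  case empty show ?case by (simp add: sign_expect_def)
next
  case (insert j I)
  then show ?case
    by (simp add: sign_expect_insert sum_fun_upd_notin sign_expect_add sign_expect_diff sign_expect_const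
        del: fun_upd_apply) (simp add: sign_expect_const sign_expect_diff sign_expect_add field_simps)
qed

text \<open>Adding \<open>j\<close> shifts the centred sum by \<open>(s - p j) * b j\<close>. The
  cross term vanishes because the old sum has mean 0, so variances add.\<close>

lemma sign_expect_variance:
  assumes "finite I"
  shows "sign_expect I p (\<lambda>\<theta>. ((\<Sum>i\<in>I. \<theta> i * b i) - (\<Sum>i\<in>I. p i * b i))\<^sup>2) = (\<Sum>i\<in>I. (b i)\<^sup>2 * (1 - (p i)\<^sup>2))"
  using assms
proof (induction I)
  case empty show ?case by (simp add: sign_expect_def)
next
  case (insert j I)
  define X where "X \<theta> = (\<Sum>i\<in>I. \<theta> i * b i) - (\<Sum>i\<in>I. p i * b i)" for \<theta>
  have X0: "sign_expect I p X = 0"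
    unfolding X_def using insert by (simp add: sign_expect_diff sign_expect_linear sign_expect_const)
  have *: "sign_expect I p (\<lambda>\<theta>. (X \<theta> + c)\<^sup>2) = sign_expect I p (\<lambda>\<theta>. (X \<theta>)\<^sup>2) + c\<^sup>2" for c
  proof -
    have "sign_expect I p (\<lambda>\<theta>. (X \<theta> + c)\<^sup>2) = sign_expect I p (\<lambda>\<theta>. ((X \<theta>)\<^sup>2 + (2 * c) * X \<theta>) + c\<^sup>2)"
      by (simp add: power2_sum algebra_simps)
    then show ?thesis
      using X0 insert by (simp only: sign_expect_add sign_expect_cmult sign_expect_const)
  qed
  have **: "(\<Sum>i\<in>insert j I. (\<theta>(j := s)) i * b i) - (\<Sum>i\<in>insert j I. p i * b i) = X \<theta> + (s - p j) * b j" for \<theta> s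
    unfolding X_def sum.insert[OF insert(1,2)] sum_fun_upd_notin[OF insert(2)]
    by (simp add: algebra_simps)
  show ?case
    using insert unfolding sign_expect_insert[OF insert(1,2)] ** * 
    by (simp add: X_def) (simp add: field_simps power2_eq_square)
qed

lemma rademacher_second_moment:
  "finite I \<Longrightarrow> sign_expect I (\<lambda>_. 0) (\<lambda>\<theta>. (\<Sum>i\<in>I. \<theta> i * b i)\<^sup>2) = (\<Sum>i\<in>I. (b i)\<^sup>2)"
  using sign_expect_variance[of I "\<lambda>_. 0" b] by simp

text \<open>Averaging over the two values of the new sign cancels the odd powers of
  \<open>X\<close>. Enlarging \<open>b j ^ 4\<close> to \<open>3 * b j ^ 4\<close> completes the
  square, which is why the factor 3 closes the induction.\<close>

lemma rademacher_fourth_moment: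
  assumes "finite I"
  shows "sign_expect I (\<lambda>_. 0) (\<lambda>\<theta>. (\<Sum>i\<in>I. \<theta> i * b i) ^ 4) \<le> 3 * (\<Sum>i\<in>I. (b i)\<^sup>2)\<^sup>2"
  using assms
proof (induction I)
  case empty show ?case by (simp add: sign_expect_def)
next
  case (insert j I)
  define X where "X \<theta> = (\<Sum>i\<in>I. \<theta> i * b i)" for \<theta>
  have s: "(\<Sum>i\<in>insert j I. (\<theta>(j := s)) i * b i) = X \<theta> + s * b j" for \<theta> s
    using insert by (simp add: X_def sum_fun_upd_notin del: fun_upd_apply) simp
  have "sign_expect (insert j I) (\<lambda>_. 0) (\<lambda>\<theta>. (\<Sum>i\<in>insert j I. \<theta> i * b i) ^ 4)
      = sign_expect I (\<lambda>_. 0) (\<lambda>\<theta>. 1 / 2 * (X \<theta> + b j) ^ 4 + 1 / 2 * (X \<theta> - b j) ^ 4)"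
    unfolding sign_expect_insert[OF insert(1,2)] s by (simp add: sign_expect_add sign_expect_divide)
  also have "\<dots> = sign_expect I (\<lambda>_. 0) (\<lambda>\<theta>. (X \<theta> ^ 4 + (6 * (b j)\<^sup>2) * (X \<theta>)\<^sup>2) + b j ^ 4)"
    by (rule sign_expect_cong) algebra
  also have "\<dots> = sign_expect I (\<lambda>_. 0) (\<lambda>\<theta>. X \<theta> ^ 4) + 6 * (b j)\<^sup>2 * (\<Sum>i\<in>I. (b i)\<^sup>2) + b j ^ 4"
    using insert by (simp only: sign_expect_add sign_expect_cmult sign_expect_const X_def rademacher_second_moment)
  also have "\<dots> \<le> 3 * (\<Sum>i\<in>I. (b i)\<^sup>2)\<^sup>2 + 6 * (b j)\<^sup>2 * (\<Sum>i\<in>I. (b i)\<^sup>2) + 3 * b j ^ 4"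
  proof -
    have "0 \<le> b j ^ 4" by simp
    then show ?thesis using insert.IH unfolding X_def by linarith
  qed
  also have "\<dots> = 3 * (\<Sum>i\<in>insert j I. (b i)\<^sup>2)\<^sup>2"
    using insert by simp algebra
  finally show ?case .
qed

text \<open>The second and fourth moments bound the first from below through a pointwise polynomial
  inequality.\<close>

lemma khinchine_lower:
  assumes "finite I"
  shows "9 / 16 * sqrt (\<Sum>i\<in>I. (b i)\<^sup>2) \<le> sign_expect I (\<lambda>_. 0) (\<lambda>\<theta>. \<bar>\<Sum>i\<in>I. \<theta> i * b i\<bar>)"
proof -
  define \<sigma> where "\<sigma> = sqrt (\<Sum>i\<in>I. (b i)\<^sup>2)"
  have s2: "\<sigma>\<^sup>2 = (\<Sum>i\<in>I. (b i)\<^sup>2)" unfolding \<sigma>_def by (simp add: sum_nonneg)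
  have s0: "\<sigma> \<ge> 0" unfolding \<sigma>_def by (simp add: sum_nonneg)
  let ?E = "sign_expect I (\<lambda>_. 0)"
  show ?thesis
  proof (cases "\<sigma> = 0")
    case True
    have "?E (\<lambda>_. 0) \<le> ?E (\<lambda>\<theta>. \<bar>\<Sum>i\<in>I. \<theta> i * b i\<bar>)" by (rule sign_expect_mono) auto
    then show ?thesis using True assms unfolding \<sigma>_def by (simp add: sign_expect_const)
  next
    case False
    then have sp: "\<sigma> > 0" using s0 by simp
    \<comment> \<open>The quartic touches \<open>16 * \<sigma> ^ 3 * \<bar>t\<bar>\<close> from
      below at \<open>\<bar>t\<bar> = 2 * \<sigma>\<close>. Its mean is at least
      \<open>12 * \<sigma> ^ 4 - 3 * \<sigma> ^ 4\<close>, whence 9 / 16.\<close>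
    have pt: "(12 * \<sigma>\<^sup>2 * t\<^sup>2 - t ^ 4) \<le> 16 * \<sigma> ^ 3 * \<bar>t\<bar>" for t :: real
    proof -
      have "0 \<le> \<bar>t\<bar> * (\<bar>t\<bar> - 2 * \<sigma>)\<^sup>2 * (\<bar>t\<bar> + 4 * \<sigma>)"
        using s0 by (intro mult_nonneg_nonneg) auto
      also have "\<dots> = \<bar>t\<bar> ^ 4 - 12 * \<sigma>\<^sup>2 * \<bar>t\<bar>\<^sup>2 + 16 * \<sigma> ^ 3 * \<bar>t\<bar>" by algebra
      finally show ?thesis by (simp add: power_even_abs)
    qed
    let ?A = "\<lambda>\<theta>. \<Sum>i\<in>I. \<theta> i * b i"
    have "9 * \<sigma> ^ 4 \<le> 12 * \<sigma>\<^sup>2 * ?E (\<lambda>\<theta>. (?A \<theta>)\<^sup>2) - ?E (\<lambda>\<theta>. (?A \<theta>) ^ 4)"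
      using rademacher_fourth_moment[OF assms, of b] rademacher_second_moment[OF assms, of b]
      unfolding s2[symmetric] by (simp add: power2_eq_square power4_eq_xxxx)
    also have "\<dots> = ?E (\<lambda>\<theta>. 12 * \<sigma>\<^sup>2 * (?A \<theta>)\<^sup>2 - (?A \<theta>) ^ 4)"
      by (simp only: sign_expect_diff sign_expect_cmult)
    also have "\<dots> \<le> ?E (\<lambda>\<theta>. 16 * \<sigma> ^ 3 * \<bar>?A \<theta>\<bar>)"
      by (rule sign_expect_mono) (auto simp: pt)
    also have "\<dots> = 16 * \<sigma> ^ 3 * ?E (\<lambda>\<theta>. \<bar>?A \<theta>\<bar>)" by (simp only: sign_expect_cmult)
    finally have "\<sigma> ^ 3 * (9 * \<sigma>) \<le> \<sigma> ^ 3 * (16 * ?E (\<lambda>\<theta>. \<bar>?A \<theta>\<bar>))"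
      by (simp add: power4_eq_xxxx power3_eq_cube algebra_simps)
    then show ?thesis using sp unfolding \<sigma>_def[symmetric] by simp
  qed
qed

section \<open>Tilted sign laws as densities over uniform signs\<close>

lemma sign_expect_tilt:
  "sign_expect I p g = sign_expect I (\<lambda>_. 0) (\<lambda>\<theta>. (\<Prod>i\<in>I. 1 + p i * \<theta> i) * g \<theta>)"
  by (simp add: sign_expect_def prod_dividef power_one_over field_simps)

text \<open>The inner product of two densities. Independence reduces it to one coordinate, where the
  mean of \<open>(1 + p i * \<theta> i) * (1 + q i * \<theta> i)\<close> is
  \<open>1 + p i * q i\<close>.\<close>

lemma sign_expect_tilt_mult:
  assumes "finite I"
  shows "sign_expect I (\<lambda>_. 0) (\<lambda>\<theta>. (\<Prod>i\<in>I. 1 + p i * \<theta> i) * (\<Prod>i\<in>I. 1 + q i * \<theta> i)) = (\<Prod>i\<in>I. 1 + p i * q i)"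
proof -
  have "(1 + 0) / 2 * ((1 + p i * 1) * (1 + q i * 1)) + (1 - 0) / 2 * ((1 + p i * - 1) * (1 + q i * - 1)) = 1 + p i * q i" for i
    by (simp add: field_simps)
  then show ?thesis
    using sign_expect_prod[OF assms, of "\<lambda>_. 0" "\<lambda>i s. (1 + p i * s) * (1 + q i * s)"]
    by (simp only: prod.distrib[symmetric])
qed

subsection \<open>Systems of functions with constant row sums\<close>

lemma abs_sign_expect_le:
  assumes "\<And>i. i \<in> I \<Longrightarrow> \<bar>p i\<bar> \<le> 1"
  shows "\<bar>sign_expect I p g\<bar> \<le> sign_expect I p (\<lambda>\<theta>. \<bar>g \<theta>\<bar>)"
proof -
  have "sign_expect I p g \<le> sign_expect I p (\<lambda>\<theta>. \<bar>g \<theta>\<bar>)"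
    using assms by (rule sign_expect_mono) auto
  moreover have "sign_expect I p (\<lambda>\<theta>. - 1 * g \<theta>) \<le> sign_expect I p (\<lambda>\<theta>. \<bar>g \<theta>\<bar>)"
    using assms by (rule sign_expect_mono) auto
  ultimately show ?thesis unfolding sign_expect_cmult by linarith
qed

text \<open>Chebyshev's inequality twice: under the tilted law the sum with coefficients
  \<open>b\<close> has mean \<open>m\<close> and variance at most \<open>R\<close>, the one with
  coefficients \<open>p\<close> has mean \<open>s\<close> and variance at most \<open>s\<close>. The
  second event later keeps the density of the tilted law below \<open>exp (2 * s)\<close>.\<close>

lemma tilted_large_deviation:
  assumes "finite I" and p: "\<And>i. i \<in> I \<Longrightarrow> \<bar>p i\<bar> \<le> 1"
    and s: "(\<Sum>i\<in>I. (p i)\<^sup>2) = s" "s > 0"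
    and m: "(\<Sum>i\<in>I. p i * b i) = m" "m > 0"
    and R: "(\<Sum>i\<in>I. (b i)\<^sup>2) \<le> R"
  shows "sign_expect I p (\<lambda>\<theta>. if (\<Sum>i\<in>I. \<theta> i * b i) \<ge> m / 2 \<and> (\<Sum>i\<in>I. \<theta> i * p i) \<le> 2 * s then 0 else 1)
    \<le> 4 * R / m\<^sup>2 + 1 / s" (is "sign_expect I p ?bad \<le> _")
proof -
  let ?X = "\<lambda>\<theta>. (\<Sum>i\<in>I. \<theta> i * b i) - (\<Sum>i\<in>I. p i * b i)"
  let ?Y = "\<lambda>\<theta>. (\<Sum>i\<in>I. \<theta> i * p i) - (\<Sum>i\<in>I. p i * p i)"
  have pp: "(\<Sum>i\<in>I. p i * p i) = s" using s by (simp add: power2_eq_square)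
  have var: "(\<Sum>i\<in>I. (c i)\<^sup>2 * (1 - (p i)\<^sup>2)) \<le> (\<Sum>i\<in>I. (c i)\<^sup>2)" for c :: "'a \<Rightarrow> real"
    by (intro sum_mono mult_left_le) auto
  have "sign_expect I p ?bad \<le> sign_expect I p (\<lambda>\<theta>. (4 / m\<^sup>2) * (?X \<theta>)\<^sup>2 + (1 / s\<^sup>2) * (?Y \<theta>)\<^sup>2)"
  proof (rule sign_expect_mono[OF p])
    fix \<theta>
    have 1: "1 \<le> (4 / m\<^sup>2) * (?X \<theta>)\<^sup>2" if "(\<Sum>i\<in>I. \<theta> i * b i) < m / 2"
    proof -
      have "(m / 2)\<^sup>2 \<le> (- ?X \<theta>)\<^sup>2" using that m by (intro power_mono) auto
      then show ?thesis using m(2) unfolding power2_minus by (simp add: field_simps)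
    qed
    have 2: "1 \<le> (1 / s\<^sup>2) * (?Y \<theta>)\<^sup>2" if "(\<Sum>i\<in>I. \<theta> i * p i) > 2 * s"
    proof -
      have "s\<^sup>2 \<le> (?Y \<theta>)\<^sup>2" using that s pp by (intro power_mono) auto
      then show ?thesis using s(2) by (simp add: field_simps)
    qed
    have n: "0 \<le> (4 / m\<^sup>2) * (?X \<theta>)\<^sup>2" "0 \<le> (1 / s\<^sup>2) * (?Y \<theta>)\<^sup>2" by auto
    show "?bad \<theta> \<le> (4 / m\<^sup>2) * (?X \<theta>)\<^sup>2 + (1 / s\<^sup>2) * (?Y \<theta>)\<^sup>2"
      using 1 2 n by (smt (verit))
  qed auto
  also have "\<dots> = 4 / m\<^sup>2 * (\<Sum>i\<in>I. (b i)\<^sup>2 * (1 - (p i)\<^sup>2)) + 1 / s\<^sup>2 * (\<Sum>i\<in>I. (p i)\<^sup>2 * (1 - (p i)\<^sup>2))"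
    by (simp only: sign_expect_add sign_expect_cmult sign_expect_variance[OF assms(1)])
  also have "\<dots> \<le> 4 / m\<^sup>2 * R + 1 / s\<^sup>2 * s"
    using var[of b] var[of p] R s by (intro add_mono mult_left_mono) auto
  also have "\<dots> = 4 * R / m\<^sup>2 + 1 / s"
    using s by (simp add: power2_eq_square)
  finally show ?thesis .
qed

lemma abs_sum_mult_le:
  fixes p q :: "'i \<Rightarrow> real"
  assumes "(\<Sum>i\<in>I. (p i)\<^sup>2) \<le> s" "(\<Sum>i\<in>I. (q i)\<^sup>2) \<le> s"
  shows "\<bar>\<Sum>i\<in>I. p i * q i\<bar> \<le> s"
proof -
  have "\<bar>\<Sum>i\<in>I. p i * q i\<bar> \<le> (\<Sum>i\<in>I. \<bar>p i * q i\<bar>)" by (rule sum_abs)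
  also have "\<dots> \<le> (\<Sum>i\<in>I. ((p i)\<^sup>2 + (q i)\<^sup>2) / 2)"
  proof (rule sum_mono)
    fix i show "\<bar>p i * q i\<bar> \<le> ((p i)\<^sup>2 + (q i)\<^sup>2) / 2"
      using zero_le_power2[of "\<bar>p i\<bar> - \<bar>q i\<bar>"] by (simp add: power2_diff abs_mult)
  qed
  also have "\<dots> \<le> s"
    using assms by (simp add: sum_divide_distrib[symmetric] sum.distrib)
  finally show ?thesis .
qed

text \<open>Bounding each factor by an exponential gives \<open>exp t\<close> with
  \<open>\<bar>t\<bar> \<le> s\<close>, and the excess of \<open>exp t\<close> over 1 is at most
  \<open>exp t * \<bar>t\<bar>\<close>.\<close>

lemma tilt_correlation_le:
  fixes p q :: "'i \<Rightarrow> real"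
  assumes "\<And>i. i \<in> I \<Longrightarrow> \<bar>p i\<bar> \<le> 1" "\<And>i. i \<in> I \<Longrightarrow> \<bar>q i\<bar> \<le> 1"
    and "(\<Sum>i\<in>I. (p i)\<^sup>2) \<le> s" "(\<Sum>i\<in>I. (q i)\<^sup>2) \<le> s"
  shows "(\<Prod>i\<in>I. 1 + p i * q i) \<le> 1 + exp s * \<bar>\<Sum>i\<in>I. p i * q i\<bar>"
proof -
  define t where "t = (\<Sum>i\<in>I. p i * q i)"
  have "(\<Prod>i\<in>I. 1 + p i * q i) \<le> (\<Prod>i\<in>I. exp (p i * q i))"
  proof (rule prod_mono)
    fix i assume "i \<in> I"
    then have "\<bar>p i * q i\<bar> \<le> 1 * 1"
      unfolding abs_mult using assms(1,2) by (intro mult_mono) auto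
    then show "0 \<le> 1 + p i * q i \<and> 1 + p i * q i \<le> exp (p i * q i)" by auto
  qed
  also have "\<dots> = exp t" unfolding t_def by (cases "finite I") (simp_all add: exp_sum)
  also have "exp t \<le> 1 + exp t * \<bar>t\<bar>"
  proof -
    have "exp t * (1 - \<bar>t\<bar>) \<le> exp t * exp (-\<bar>t\<bar>)"
      using exp_ge_add_one_self[of "-\<bar>t\<bar>"] by (intro mult_left_mono) auto
    also have "\<dots> \<le> 1" unfolding exp_add[symmetric] by simp
    finally show ?thesis by (simp add: algebra_simps)
  qed
  also have "\<dots> \<le> 1 + exp s * \<bar>t\<bar>"
    using abs_sum_mult_le[OF assms(3,4)] unfolding t_def[symmetric]
    by (intro add_left_mono mult_right_mono) auto
  finally show ?thesis unfolding t_def .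
qed

text \<open>A matrix with rows indexed by points and columns by functions. Constant row sums bound
  every entry by the number of columns, which settles integrability; unit column norms control
  averages over the points.\<close>

locale sign_system = prob_space N for N :: "'a measure" +
  fixes I :: "'i set" and a :: "'i \<Rightarrow> 'a \<Rightarrow> real"
  assumes finite_I: "finite I" and I_ne: "I \<noteq> {}"
    and a_meas [measurable]: "\<And>i. i \<in> I \<Longrightarrow> a i \<in> borel_measurable N"
    and row: "\<And>x. x \<in> space N \<Longrightarrow> (\<Sum>i\<in>I. \<bar>a i x\<bar>) = card I"
    and col: "\<And>i. i \<in> I \<Longrightarrow> (\<integral>x. \<bar>a i x\<bar> \<partial>N) = 1"
begin

definition n :: real where "n = card I"
definition A :: "('i \<Rightarrow> real) \<Rightarrow> 'a \<Rightarrow> real" where "A \<theta> x = (\<Sum>i\<in>I. \<theta> i * a i x)"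
definition sqn :: "'a \<Rightarrow> real" where "sqn x = (\<Sum>i\<in>I. (a i x)\<^sup>2)"
text \<open>By Khinchine's inequality this is, up to constant factors, the mean over uniform signs
  of the \<open>L1\<close> norm of \<open>A \<theta>\<close>.\<close>

definition M :: real where "M = (\<integral>x. sqrt (sqn x) \<partial>N)"

section \<open>Pointwise bounds and integrability\<close>

lemma n_ge1: "n \<ge> 1"
  using finite_I I_ne unfolding n_def by (simp add: Suc_leI card_gt_0_iff)

lemma A_meas [measurable]: "A \<theta> \<in> borel_measurable N"
  unfolding A_def by measurable

lemma sqn_meas [measurable]: "sqn \<in> borel_measurable N"
  unfolding sqn_def by measurable

lemma a_bound: assumes "x \<in> space N" "i \<in> I" shows "\<bar>a i x\<bar> \<le> n"
proof -
  have "\<bar>a i x\<bar> \<le> (\<Sum>i\<in>I. \<bar>a i x\<bar>)"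
    using finite_I assms by (intro member_le_sum) auto
  then show ?thesis using row assms unfolding n_def by simp
qed

lemma bounded_integrable:
  fixes f :: "'a \<Rightarrow> real"
  assumes "\<And>x. x \<in> space N \<Longrightarrow> \<bar>f x\<bar> \<le> C" "f \<in> borel_measurable N"
  shows "integrable N f"
  using assms by (intro integrable_const_bound[of _ C]) auto

lemma a_integrable: "i \<in> I \<Longrightarrow> integrable N (a i)"
  using a_bound by (intro bounded_integrable[of _ n]) auto

lemma A_integrable: "integrable N (A \<theta>)"
  unfolding A_def[abs_def] using a_integrable by auto

lemma sqn_ge: assumes "x \<in> space N" shows "n \<le> sqn x"
proof -
  have "n\<^sup>2 = (\<Sum>i\<in>I. 1 * \<bar>a i x\<bar>)\<^sup>2" using row assms unfolding n_def by simp
  also have "\<dots> \<le> (\<Sum>i\<in>I. 1\<^sup>2) * (\<Sum>i\<in>I. \<bar>a i x\<bar>\<^sup>2)" by (rule Cauchy_Schwarz_ineq_sum)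
  also have "\<dots> = n * sqn x" by (simp add: n_def sqn_def)
  finally show ?thesis using n_ge1 by (simp add: power2_eq_square)
qed

lemma sqn_le: assumes "x \<in> space N" shows "sqn x \<le> n\<^sup>2"
proof -
  have "sqn x \<le> (\<Sum>i\<in>I. n * \<bar>a i x\<bar>)"
    unfolding sqn_def
  proof (rule sum_mono)
    fix i assume "i \<in> I"
    then show "(a i x)\<^sup>2 \<le> n * \<bar>a i x\<bar>"
      using mult_right_mono[OF a_bound[OF assms], of i "\<bar>a i x\<bar>"] by (simp add: power2_eq_square)
  qed
  also have "\<dots> = n * n" using row[OF assms] by (simp add: sum_distrib_left[symmetric] n_def)
  finally show ?thesis by (simp add: power2_eq_square)
qed

lemma sqrt_sqn_integrable: "integrable N (\<lambda>x. sqrt (sqn x))"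
proof (rule bounded_integrable[of _ n])
  fix x assume x: "x \<in> space N"
  have "sqrt (sqn x) \<le> n" using sqn_le[OF x] n_ge1 by (simp add: real_le_lsqrt)
  then show "\<bar>sqrt (sqn x)\<bar> \<le> n" using sqn_ge[OF x] n_ge1 by simp
qed simp

lemma M_ge: "sqrt n \<le> M"
proof -
  have "(\<integral>x. sqrt n \<partial>N) \<le> M"
    unfolding M_def using sqn_ge sqrt_sqn_integrable by (intro integral_mono) auto
  then show ?thesis by (simp add: prob_space)
qed

lemma M_pos: "M > 0"
  using M_ge n_ge1 by (smt (verit) real_sqrt_gt_zero)

section \<open>Means over signs of integrated quantities\<close>

lemma integrable_sign_expect:
  assumes "\<And>\<theta>. \<theta> \<in> signs I \<Longrightarrow> integrable N (g \<theta>)"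
  shows "integrable N (\<lambda>x. sign_expect I p (\<lambda>\<theta>. g \<theta> x))"
  using assms unfolding sign_expect_def by auto

lemma integral_sign_expect:
  assumes "\<And>\<theta>. \<theta> \<in> signs I \<Longrightarrow> integrable N (g \<theta>)"
  shows "(\<integral>x. sign_expect I p (\<lambda>\<theta>. g \<theta> x) \<partial>N) = sign_expect I p (\<lambda>\<theta>. \<integral>x. g \<theta> x \<partial>N)"
  using assms unfolding sign_expect_def by (subst Bochner_Integration.integral_sum) auto

text \<open>A point of the cube is the mean of a product measure on its vertices.\<close>
lemma cube_integral_le:
  assumes T: "\<And>\<theta>. \<theta> \<in> signs I \<Longrightarrow> (\<integral>x. \<bar>A \<theta> x\<bar> \<partial>N) \<le> T"
    and m: "\<And>i. i \<in> I \<Longrightarrow> \<bar>m i\<bar> \<le> B" and "B > 0"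
  shows "(\<integral>x. \<bar>A m x\<bar> \<partial>N) \<le> B * T"
proof -
  define q where "q i = m i / B" for i
  have q: "\<bar>q i\<bar> \<le> 1" if "i \<in> I" for i
    using m[OF that] \<open>B > 0\<close> by (simp add: q_def field_simps)
  have Am: "\<bar>A m x\<bar> = B * \<bar>A q x\<bar>" for x
    using \<open>B > 0\<close> by (simp add: A_def q_def sum_divide_distrib[symmetric] abs_mult)
  have "(\<integral>x. \<bar>A q x\<bar> \<partial>N) \<le> (\<integral>x. sign_expect I q (\<lambda>\<theta>. \<bar>A \<theta> x\<bar>) \<partial>N)"
  proof (rule integral_mono)
    show "integrable N (\<lambda>x. sign_expect I q (\<lambda>\<theta>. \<bar>A \<theta> x\<bar>))"
      using A_integrable by (intro integrable_sign_expect) auto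
    fix x
    have "A q x = sign_expect I q (\<lambda>\<theta>. A \<theta> x)"
      unfolding A_def using sign_expect_linear[OF finite_I, of q "\<lambda>i. a i x"] by simp
    then show "\<bar>A q x\<bar> \<le> sign_expect I q (\<lambda>\<theta>. \<bar>A \<theta> x\<bar>)"
      using abs_sign_expect_le[OF q] by simp
  qed (use A_integrable in auto)
  also have "\<dots> = sign_expect I q (\<lambda>\<theta>. \<integral>x. \<bar>A \<theta> x\<bar> \<partial>N)"
    using A_integrable by (intro integral_sign_expect) auto
  also have "\<dots> \<le> sign_expect I q (\<lambda>_. T)"
    using q T by (rule sign_expect_mono)
  finally have "(\<integral>x. \<bar>A q x\<bar> \<partial>N) \<le> T" using finite_I by (simp add: sign_expect_const)
  then show ?thesis unfolding Am using \<open>B > 0\<close> by simp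
qed

text \<open>Khinchine's inequality at each point, integrated.\<close>

lemma mean_L1_norm_ge:
  "9 / 16 * M \<le> sign_expect I (\<lambda>_. 0) (\<lambda>\<theta>. \<integral>x. \<bar>A \<theta> x\<bar> \<partial>N)"
proof -
  have "9 / 16 * M = (\<integral>x. 9 / 16 * sqrt (sqn x) \<partial>N)" by (simp add: M_def)
  also have "\<dots> \<le> (\<integral>x. sign_expect I (\<lambda>_. 0) (\<lambda>\<theta>. \<bar>A \<theta> x\<bar>) \<partial>N)"
    using sqrt_sqn_integrable A_integrable khinchine_lower[OF finite_I]
    unfolding sqn_def A_def
    by (intro integral_mono integrable_sign_expect integrable_mult_right) auto
  also have "\<dots> = sign_expect I (\<lambda>_. 0) (\<lambda>\<theta>. \<integral>x. \<bar>A \<theta> x\<bar> \<partial>N)"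
    using A_integrable by (intro integral_sign_expect) auto
  finally show ?thesis .
qed

lemma ex_L1_norm_ge: "\<exists>\<theta>\<in>signs I. 9 / 16 * M \<le> (\<integral>x. \<bar>A \<theta> x\<bar> \<partial>N)"
proof (rule ccontr)
  let ?Y = "\<lambda>\<theta>. \<integral>x. \<bar>A \<theta> x\<bar> \<partial>N"
  assume "\<not> ?thesis"
  then have less: "?Y \<theta> < 9 / 16 * M" if "\<theta> \<in> signs I" for \<theta> using that by force
  have ne: "signs I \<noteq> {}" by (simp add: signs_def PiE_eq_empty_iff)
  let ?m = "Max (?Y ` signs I)"
  have "?m < 9 / 16 * M" using finite_signs[OF finite_I] ne less by (subst Max_less_iff) blast+
  moreover have "sign_expect I (\<lambda>_. 0) ?Y \<le> sign_expect I (\<lambda>_. 0) (\<lambda>_. ?m)"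
    by (rule sign_expect_mono) (use finite_signs[OF finite_I] in auto)
  ultimately show False
    using mean_L1_norm_ge finite_I by (simp add: sign_expect_const)
qed

text \<open>The Paley--Zygmund argument, with Cauchy--Schwarz replaced by the pointwise
  \<open>\<bar>A\<bar> \<le> A\<^sup>2 / (8\<sigma>) + 2\<sigma>\<close>, \<open>\<sigma> = sqrt (sqn x)\<close>.\<close>
lemma prob_L1_norm_ge:
  "3 / 32 \<le> sign_expect I (\<lambda>_. 0) (\<lambda>\<theta>. if M / 4 \<le> (\<integral>x. \<bar>A \<theta> x\<bar> \<partial>N) then 1 else 0)"
proof -
  let ?E = "sign_expect I (\<lambda>_. 0)"
  let ?Y = "\<lambda>\<theta>. \<integral>x. \<bar>A \<theta> x\<bar> \<partial>N"
  let ?Z = "\<lambda>\<theta>. \<integral>x. (A \<theta> x)\<^sup>2 / sqrt (sqn x) \<partial>N"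
  let ?ind = "\<lambda>\<theta>. if M / 4 \<le> ?Y \<theta> then 1 else 0 :: real"
  have sp: "sqrt (sqn x) > 0" if "x \<in> space N" for x using sqn_ge[OF that] n_ge1 by simp
  have intZ: "integrable N (\<lambda>x. (A \<theta> x)\<^sup>2 / sqrt (sqn x))" if "\<theta> \<in> signs I" for \<theta>
  proof (rule bounded_integrable[of _ "n\<^sup>2 / 1"])
    fix x assume x: "x \<in> space N"
    have "\<bar>A \<theta> x\<bar> \<le> (\<Sum>i\<in>I. \<bar>\<theta> i * a i x\<bar>)" unfolding A_def by (rule sum_abs)
    also have "\<dots> = n"
    proof -
      have "(\<Sum>i\<in>I. \<bar>\<theta> i * a i x\<bar>) = (\<Sum>i\<in>I. \<bar>a i x\<bar>)"
        using signs_cases[OF that] by (intro sum.cong) (force simp: abs_mult)+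
      then show ?thesis using row[OF x] by (simp add: n_def)
    qed
    finally have "(A \<theta> x)\<^sup>2 \<le> n\<^sup>2" using n_ge1 by (intro power2_le_iff_abs_le[THEN iffD2]) auto
    moreover have "1 \<le> sqrt (sqn x)" using sqn_ge[OF x] n_ge1 by simp
    ultimately have "(A \<theta> x)\<^sup>2 / sqrt (sqn x) \<le> n\<^sup>2 / 1" by (intro frac_le) auto
    then show "\<bar>(A \<theta> x)\<^sup>2 / sqrt (sqn x)\<bar> \<le> n\<^sup>2 / 1" using sp[OF x] by simp
  qed simp
  \<comment> \<open>Division by \<open>sqrt (sqn x)\<close> reduces the second moment
    \<open>sqn x\<close> to its square root, so the mean is exactly \<open>M\<close>.\<close>
  have EZ: "?E ?Z = M"
  proof -
    have "?E ?Z = (\<integral>x. ?E (\<lambda>\<theta>. (A \<theta> x)\<^sup>2 / sqrt (sqn x)) \<partial>N)"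
      by (rule integral_sign_expect[symmetric]) (rule intZ)
    also have "\<dots> = M" unfolding M_def
    proof (intro Bochner_Integration.integral_cong refl)
      fix x assume "x \<in> space N"
      show "?E (\<lambda>\<theta>. (A \<theta> x)\<^sup>2 / sqrt (sqn x)) = sqrt (sqn x)"
        using rademacher_second_moment[OF finite_I, of "\<lambda>i. a i x"] sp[OF \<open>x \<in> space N\<close>]
        by (simp add: sign_expect_divide A_def sqn_def[symmetric] real_div_sqrt)
    qed
    finally show ?thesis .
  qed
  have "9 / 16 * M \<le> ?E ?Y" by (rule mean_L1_norm_ge)
  \<comment> \<open>If the indicator is 0, then \<open>?Y \<theta>\<close> is below
    \<open>M / 4\<close>; otherwise it is at most \<open>?Z \<theta> / 8 + 2 * M\<close>. Taking
    means leaves 9/16 - 1/4 - 1/8 = 3/16 for twice the probability.\<close>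
  also have "\<dots> \<le> ?E (\<lambda>\<theta>. (M / 4 + 1 / 8 * ?Z \<theta>) + 2 * M * ?ind \<theta>)"
  proof (rule sign_expect_mono)
    fix \<theta> assume t: "\<theta> \<in> signs I"
    have "?Y \<theta> \<le> (\<integral>x. 1 / 8 * ((A \<theta> x)\<^sup>2 / sqrt (sqn x)) + 2 * sqrt (sqn x) \<partial>N)"
    proof (rule integral_mono)
      fix x assume "x \<in> space N"
      then have s: "sqrt (sqn x) > 0" by (rule sp)
      have "0 \<le> (\<bar>A \<theta> x\<bar> - 4 * sqrt (sqn x))\<^sup>2" by simp
      then have "\<bar>A \<theta> x\<bar> * (8 * sqrt (sqn x)) \<le> (A \<theta> x)\<^sup>2 + 16 * (sqrt (sqn x))\<^sup>2"
        by (simp add: power2_diff power_mult_distrib algebra_simps del: real_sqrt_pow2_iff real_sqrt_pow2)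
      then have "\<bar>A \<theta> x\<bar> \<le> ((A \<theta> x)\<^sup>2 + 16 * (sqrt (sqn x))\<^sup>2) / (8 * sqrt (sqn x))"
        using s by (subst pos_le_divide_eq) auto
      also have "\<dots> = 1 / 8 * ((A \<theta> x)\<^sup>2 / sqrt (sqn x)) + 2 * sqrt (sqn x)"
        using s by (simp add: add_divide_distrib power2_eq_square del: real_sqrt_mult_self)
      finally show "\<bar>A \<theta> x\<bar> \<le> 1 / 8 * ((A \<theta> x)\<^sup>2 / sqrt (sqn x)) + 2 * sqrt (sqn x)" .
    next
      show "integrable N (\<lambda>x. 1 / 8 * ((A \<theta> x)\<^sup>2 / sqrt (sqn x)) + 2 * sqrt (sqn x))"
        using intZ[OF t] sqrt_sqn_integrable by (intro Bochner_Integration.integrable_add integrable_mult_right) auto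
    qed (use A_integrable in auto)
    also have "\<dots> = (\<integral>x. 1 / 8 * ((A \<theta> x)\<^sup>2 / sqrt (sqn x)) \<partial>N) + (\<integral>x. 2 * sqrt (sqn x) \<partial>N)"
      using intZ[OF t] sqrt_sqn_integrable by (intro Bochner_Integration.integral_add integrable_mult_right)
    also have "\<dots> = 1 / 8 * ?Z \<theta> + 2 * M"
      by (simp only: M_def integral_mult_right_zero)
    finally have 1: "?Y \<theta> \<le> 1 / 8 * ?Z \<theta> + 2 * M" .
    have "0 \<le> ?Z \<theta>" using sp by (intro integral_nonneg_AE) (auto simp: less_imp_le)
    then show "?Y \<theta> \<le> (M / 4 + 1 / 8 * ?Z \<theta>) + 2 * M * ?ind \<theta>"
      using 1 M_pos by auto
  qed auto
  also have "\<dots> = M / 4 + 1 / 8 * ?E ?Z + 2 * M * ?E ?ind"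
    by (simp only: sign_expect_add sign_expect_cmult sign_expect_const[OF finite_I])
  finally have "M * (3 / 16) \<le> M * (2 * ?E ?ind)" unfolding EZ by (simp add: algebra_simps)
  then show ?thesis using M_pos by simp
qed

subsection \<open>Failure probability of one level\<close>

text \<open>Large entries are dropped, not clipped, so
  \<open>trunc B i x * a i x = (trunc B i x)\<^sup>2\<close>. A tilt along the truncated row then
  gives \<open>A \<theta> x\<close> a mean proportional to the energy of that row.\<close>

definition trunc :: "real \<Rightarrow> 'i \<Rightarrow> 'a \<Rightarrow> real" where
  "trunc B i x = (if \<bar>a i x\<bar> < B then a i x else 0)"

lemma trunc_meas [measurable]: "i \<in> I \<Longrightarrow> trunc B i \<in> borel_measurable N"
  unfolding trunc_def by measurable

lemma abs_trunc_le: "B > 0 \<Longrightarrow> \<bar>trunc B i x\<bar> \<le> B" "\<bar>trunc B i x\<bar> \<le> \<bar>a i x\<bar>"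
  by (auto simp: trunc_def)

text \<open>A dropped entry has size at least \<open>B\<close>, so its size is at most
  \<open>(a i x)\<^sup>2 / B\<close>.\<close>

lemma sum_tail_le:
  assumes "B > 0" "sqn x \<le> R"
  shows "(\<Sum>i\<in>I. \<bar>a i x - trunc B i x\<bar>) \<le> R / B"
proof -
  have "(\<Sum>i\<in>I. \<bar>a i x - trunc B i x\<bar>) \<le> (\<Sum>i\<in>I. (a i x)\<^sup>2 / B)"
  proof (rule sum_mono)
    fix i
    have "\<bar>a i x\<bar> \<le> (a i x)\<^sup>2 / B" if "B \<le> \<bar>a i x\<bar>"
      using mult_right_mono[OF that, of "\<bar>a i x\<bar>"] assms by (simp add: field_simps power2_eq_square)
    then show "\<bar>a i x - trunc B i x\<bar> \<le> (a i x)\<^sup>2 / B"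
      using assms by (auto simp: trunc_def)
  qed
  also have "\<dots> \<le> R / B"
    using assms by (simp add: sum_divide_distrib[symmetric] sqn_def[symmetric] divide_right_mono)
  finally show ?thesis .
qed

text \<open>The dropped entries carry at most half of the row sum \<open>n\<close>; Cauchy--Schwarz
  turns the remaining \<open>n / 2\<close> into the energy \<open>n / 4\<close>.\<close>

lemma trunc_sqn_ge:
  assumes "x \<in> space N" "B > 0" "sqn x \<le> R" "R / B \<le> n / 2"
  shows "n / 4 \<le> (\<Sum>i\<in>I. (trunc B i x)\<^sup>2)"
proof -
  have "n = (\<Sum>i\<in>I. \<bar>trunc B i x\<bar>) + (\<Sum>i\<in>I. \<bar>a i x - trunc B i x\<bar>)"
    unfolding sum.distrib[symmetric] n_def row[OF assms(1), symmetric]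
    by (intro sum.cong) (auto simp: trunc_def)
  then have "n / 2 \<le> (\<Sum>i\<in>I. 1 * \<bar>trunc B i x\<bar>)"
    using sum_tail_le[OF assms(2,3)] assms(4) unfolding mult_1 by linarith
  then have "(n / 2)\<^sup>2 \<le> (\<Sum>i\<in>I. 1 * \<bar>trunc B i x\<bar>)\<^sup>2"
    using n_ge1 by (intro power_mono) auto
  also have "\<dots> \<le> (\<Sum>i\<in>I. 1\<^sup>2) * (\<Sum>i\<in>I. \<bar>trunc B i x\<bar>\<^sup>2)" by (rule Cauchy_Schwarz_ineq_sum)
  also have "\<dots> = n * (\<Sum>i\<in>I. (trunc B i x)\<^sup>2)" by (simp add: n_def)
  finally show ?thesis using n_ge1 by (simp add: power2_eq_square)
qed

lemma trunc_integrable: "i \<in> I \<Longrightarrow> integrable N (trunc B i)"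
  by (rule bounded_integrable[of _ n]) (use a_bound abs_trunc_le(2) order_trans in \<open>auto, blast\<close>)

text \<open>The mass that column \<open>i\<close> loses by truncation. It is restricted to
  \<open>E\<close> because the bound on \<open>sqn\<close> that controls the loss is assumed only
  there.\<close>

definition tail_mean :: "real \<Rightarrow> 'a set \<Rightarrow> 'i \<Rightarrow> real" where
  "tail_mean B E i = (\<integral>y. indicator E y * \<bar>a i y - trunc B i y\<bar> \<partial>N)"

lemma tail_integrable:
  assumes "i \<in> I" "E \<in> sets N"
  shows "integrable N (\<lambda>y. indicator E y * \<bar>a i y - trunc B i y\<bar>)"
  using a_integrable[OF assms(1)] trunc_integrable[OF assms(1), of B] assms(2)
  by (intro integrable_real_mult_indicator[where 'a='a, simplified mult.commute[of _ "indicator _ _"]]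
      integrable_abs Bochner_Integration.integrable_diff) auto

lemma sum_tail_mean_le:
  assumes "E \<in> sets N" "B > 0" "\<And>x. x \<in> E \<Longrightarrow> sqn x \<le> R" "R \<ge> 0"
  shows "(\<Sum>i\<in>I. tail_mean B E i) \<le> R / B"
proof -
  have "(\<Sum>i\<in>I. tail_mean B E i) = (\<integral>y. (\<Sum>i\<in>I. indicator E y * \<bar>a i y - trunc B i y\<bar>) \<partial>N)"
    unfolding tail_mean_def using tail_integrable[OF _ assms(1)] by (subst Bochner_Integration.integral_sum) auto
  also have "\<dots> \<le> (\<integral>y. R / B \<partial>N)"
  proof (rule integral_mono)
    fix y
    show "(\<Sum>i\<in>I. indicator E y * \<bar>a i y - trunc B i y\<bar>) \<le> R / B"
      using sum_tail_le[OF assms(2), of y R] assms(2-4) by (cases "y \<in> E") auto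
  qed (use tail_integrable[OF _ assms(1)] in auto)
  finally show ?thesis by (simp add: prob_space)
qed

text \<open>The first summand uses that no choice of signs has a large \<open>L\<^sub>1\<close> norm; the second is small
  after integration over \<open>x\<close> because every column has mean 1.\<close>
lemma truncated_correlation_le:
  assumes T: "\<And>\<theta>. \<theta> \<in> signs I \<Longrightarrow> (\<integral>x. \<bar>A \<theta> x\<bar> \<partial>N) \<le> T"
    and E: "E \<in> sets N" and B: "B > 0"
  shows "(\<integral>y. indicator E y * \<bar>\<Sum>i\<in>I. trunc B i x * trunc B i y\<bar> \<partial>N)
    \<le> B * T + (\<Sum>i\<in>I. \<bar>trunc B i x\<bar> * tail_mean B E i)"
proof -
  let ?t = "\<lambda>y. \<Sum>i\<in>I. \<bar>trunc B i x\<bar> * (indicator E y * \<bar>a i y - trunc B i y\<bar>)"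
  have "(\<integral>y. indicator E y * \<bar>\<Sum>i\<in>I. trunc B i x * trunc B i y\<bar> \<partial>N)
      \<le> (\<integral>y. \<bar>A (\<lambda>i. trunc B i x) y\<bar> + ?t y \<partial>N)"
  proof (rule integral_mono')
    show "integrable N (\<lambda>y. \<bar>A (\<lambda>i. trunc B i x) y\<bar> + ?t y)"
      using A_integrable tail_integrable[OF _ E]
      by (intro Bochner_Integration.integrable_add Bochner_Integration.integrable_sum
          integrable_mult_right integrable_abs) auto
    fix y
    show "indicator E y * \<bar>\<Sum>i\<in>I. trunc B i x * trunc B i y\<bar> \<le> \<bar>A (\<lambda>i. trunc B i x) y\<bar> + ?t y"
    proof (cases "y \<in> E")
      case True
      \<comment> \<open>Replacing \<open>trunc B i y\<close> by \<open>a i y\<close> produces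
        \<open>A\<close> with the bounded coefficients \<open>trunc B i x\<close>, whose norm is
        controlled by that of sign sums. The replacement costs the tail at \<open>y\<close>.\<close>
      have "(\<Sum>i\<in>I. trunc B i x * trunc B i y) =
          A (\<lambda>i. trunc B i x) y - (\<Sum>i\<in>I. trunc B i x * (a i y - trunc B i y))"
        by (simp add: A_def sum_subtractf[symmetric] algebra_simps)
      also have "\<bar>\<dots>\<bar> \<le> \<bar>A (\<lambda>i. trunc B i x) y\<bar> + \<bar>\<Sum>i\<in>I. trunc B i x * (a i y - trunc B i y)\<bar>"
        by (rule abs_triangle_ineq4)
      also have "\<bar>\<Sum>i\<in>I. trunc B i x * (a i y - trunc B i y)\<bar> \<le> ?t y"
        using True by (intro order_trans[OF sum_abs]) (simp add: abs_mult)
      finally show ?thesis using True by simp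
    qed (auto intro!: add_nonneg_nonneg sum_nonneg)
  qed (auto intro!: add_nonneg_nonneg sum_nonneg)
  also have "\<dots> = (\<integral>y. \<bar>A (\<lambda>i. trunc B i x) y\<bar> \<partial>N) + (\<Sum>i\<in>I. \<bar>trunc B i x\<bar> * tail_mean B E i)"
    using A_integrable tail_integrable[OF _ E]
    by (subst Bochner_Integration.integral_add) (auto simp: Bochner_Integration.integral_sum tail_mean_def)
  also have "(\<integral>y. \<bar>A (\<lambda>i. trunc B i x) y\<bar> \<partial>N) \<le> B * T"
    using T abs_trunc_le(1)[OF B] B by (rule cube_integral_le)
  finally show ?thesis by simp
qed

text \<open>A second moment argument. The average \<open>W\<close> over \<open>E\<close> of the
  tilted densities has mean \<open>prob E\<close>, and the expression multiplied by 29 bounds its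
  variance. The expression multiplied by 11 bounds the mean of \<open>Bad\<close>, the part of
  \<open>W\<close> where the tilt misses its target. A failure forces \<open>W\<close> far from its
  mean or \<open>Bad\<close> to be large.\<close>

lemma level_failure:
  assumes T: "\<And>\<theta>. \<theta> \<in> signs I \<Longrightarrow> (\<integral>x. \<bar>A \<theta> x\<bar> \<partial>N) \<le> T"
    and D: "D \<in> sets N" and E_def: "E = {x \<in> D. sqn x \<le> R}" and E: "3 / 8 \<le> prob E"
    and B: "B > 0" and RB: "R / B \<le> n / 2" and kB: "real k * B\<^sup>2 \<le> 2 * n" and k: "k \<ge> 4" and R: "R \<ge> 0"
  shows "sign_expect I (\<lambda>_. 0) (\<lambda>\<theta>. if prob {x \<in> D. sqrt (k * n / 128) \<le> A \<theta> x} < 1 / 2 ^ k / 2 then 1 else 0)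
    \<le> 29 * (exp (k / 8) * (k / (2 * n)) * (B * T + R / B)) + 11 * ((128 * R / n + 8) / k)"
proof -
  let ?E0 = "sign_expect I (\<lambda>_. 0)"
  define e0 where "e0 = prob E"
  define g :: "'a \<Rightarrow> real" where "g = indicator E"
  \<comment> \<open>Two demands fix the energy of the tilt: \<open>exp (2 * s) = exp (k / 4)\<close>
    has to be small against \<open>2 ^ k\<close>, and half the tilted mean, \<open>m x / 2\<close>,
    has to reach \<open>sqrt (k * n / 128)\<close>.\<close>
  define s where "s = real k / 8"
  define tn where "tn x = (\<Sum>i\<in>I. (trunc B i x)\<^sup>2)" for x
  \<comment> \<open>The tilt points along the truncated row and has energy \<open>s\<close>; off
    \<open>E\<close> the signs stay uniform.\<close>
  define p where "p i x = (if x \<in> E then sqrt s * trunc B i x / sqrt (tn x) else 0)" for i x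
  define w where "w \<theta> x = (\<Prod>i\<in>I. 1 + p i x * \<theta> i)" for \<theta> x
  define m where "m x = sqrt s * sqrt (tn x)" for x
  define bad :: "('i \<Rightarrow> real) \<Rightarrow> 'a \<Rightarrow> real" where
    "bad \<theta> x = (if m x / 2 \<le> A \<theta> x \<and> (\<Sum>i\<in>I. \<theta> i * p i x) \<le> 2 * s then 0 else 1)" for \<theta> x
  define W where "W \<theta> = (\<integral>x. g x * w \<theta> x \<partial>N)" for \<theta>
  define Bad where "Bad \<theta> = (\<integral>x. g x * (w \<theta> x * bad \<theta> x) \<partial>N)" for \<theta>
  define c where "c = tail_mean B E"
  define Q where "Q = exp s * (4 * s / n)"
  define b where "b = (128 * R / n + 8) / k"
  have s0: "s > 0" using k by (simp add: s_def)
  have n0: "n > 0" using n_ge1 by simp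
  have E_meas [measurable]: "E \<in> sets N"
    unfolding E_def using D by measurable
  have E_space: "x \<in> space N" if "x \<in> E" for x using that E_meas sets.sets_into_space by blast
  have g_meas [measurable]: "g \<in> borel_measurable N" unfolding g_def by measurable
  have tn_meas [measurable]: "tn \<in> borel_measurable N" unfolding tn_def by measurable
  have p_meas [measurable]: "p i \<in> borel_measurable N" if "i \<in> I" for i
    unfolding p_def using that by measurable
  have w_meas [measurable]: "w \<theta> \<in> borel_measurable N" for \<theta> unfolding w_def by measurable
  have m_meas [measurable]: "m \<in> borel_measurable N" unfolding m_def by measurable
  have bad_meas [measurable]: "bad \<theta> \<in> borel_measurable N" for \<theta> unfolding bad_def by measurable
  have g01: "0 \<le> g x" "g x \<le> 1" for x by (auto simp: g_def)
  have bad01: "0 \<le> bad \<theta> x" "bad \<theta> x \<le> 1" for \<theta> x by (auto simp: bad_def)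
  have tn_ge: "n / 4 \<le> tn x" if "x \<in> E" for x
    unfolding tn_def using that E_space[OF that] B RB by (intro trunc_sqn_ge) (auto simp: E_def)
  have p2: "(\<Sum>i\<in>I. (p i x)\<^sup>2) = s" if "x \<in> E" for x
  proof -
    have "(\<Sum>i\<in>I. (p i x)\<^sup>2) = (\<Sum>i\<in>I. s / tn x * (trunc B i x)\<^sup>2)"
      using that tn_ge[OF that] n0 s0 by (intro sum.cong) (auto simp: p_def power_divide power_mult_distrib)
    also have "\<dots> = s / tn x * tn x" by (simp only: sum_distrib_left[symmetric] tn_def)
    also have "\<dots> = s" using tn_ge[OF that] n0 by simp
    finally show ?thesis .
  qed
  \<comment> \<open>Truncation at \<open>B\<close> together with \<open>kB\<close> makes the tilt a
    genuine law of signs.\<close>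
  have p1: "\<bar>p i x\<bar> \<le> 1" for i x
  proof (cases "x \<in> E")
    case True
    have "(p i x)\<^sup>2 = s * (trunc B i x)\<^sup>2 / tn x"
      using True tn_ge[OF True] n0 s0 by (auto simp: p_def power_divide power_mult_distrib)
    also have "\<dots> \<le> s * B\<^sup>2 / (n / 4)"
      using abs_trunc_le(1)[OF B, of i x] s0 n0 tn_ge[OF True] B
      by (intro frac_le mult_left_mono) (auto simp: power2_le_iff_abs_le)
    also have "\<dots> \<le> 1" using kB n0 by (simp add: s_def field_simps)
    finally show ?thesis by (simp add: abs_square_le_1)
  qed (simp add: p_def)
  have w_nonneg: "0 \<le> w \<theta> x" if "\<theta> \<in> signs I" for \<theta> x
    unfolding w_def by (rule signs_weight_nonneg[OF that p1])
  have w_exp: "w \<theta> x \<le> exp (\<Sum>i\<in>I. \<theta> i * p i x)" if "\<theta> \<in> signs I" for \<theta> x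
    unfolding w_def exp_sum[OF finite_I]
  proof (rule prod_mono)
    fix i assume "i \<in> I"
    then have "\<bar>p i x * \<theta> i\<bar> \<le> 1" using p1[of i x] signs_cases[OF that] by (force simp: abs_mult)
    then show "0 \<le> 1 + p i x * \<theta> i \<and> 1 + p i x * \<theta> i \<le> exp (\<theta> i * p i x)"
      by (auto simp: mult.commute)
  qed
  \<comment> \<open>A crude bound that serves integrability.\<close>
  have w_le: "w \<theta> x \<le> exp n" if "\<theta> \<in> signs I" for \<theta> x
  proof -
    have "(\<Sum>i\<in>I. \<theta> i * p i x) \<le> (\<Sum>i\<in>I. 1)"
    proof (rule sum_mono)
      fix i assume "i \<in> I" then show "\<theta> i * p i x \<le> 1"
        using p1[of i x] signs_cases[OF that] by force
    qed
    then show ?thesis using w_exp[OF that, of x] by (smt (verit) n_def card_eq_sum exp_le_cancel_iff of_nat_1 of_nat_sum sum.cong)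
  qed
  have gw_int: "integrable N (\<lambda>x. g x * w \<theta> x)" if "\<theta> \<in> signs I" for \<theta>
  proof (rule bounded_integrable)
    fix x
    have "g x * w \<theta> x \<le> 1 * exp n"
      using w_nonneg[OF that] w_le[OF that] g01 by (intro mult_mono) auto
    then show "\<bar>g x * w \<theta> x\<bar> \<le> 1 * exp n"
      using w_nonneg[OF that] g01 by simp
  qed simp
  have gwb_int: "integrable N (\<lambda>x. g x * (w \<theta> x * bad \<theta> x))" if "\<theta> \<in> signs I" for \<theta>
  proof (rule bounded_integrable)
    fix x
    have "g x * (w \<theta> x * bad \<theta> x) \<le> 1 * (exp n * 1)"
      using w_nonneg[OF that] w_le[OF that] g01 bad01
      by (intro mult_mono mult_nonneg_nonneg) auto
    then show "\<bar>g x * (w \<theta> x * bad \<theta> x)\<bar> \<le> 1 * (exp n * 1)"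
      using w_nonneg[OF that] g01 bad01 by simp
  qed simp
  have gww_int: "integrable N (\<lambda>y. g y * (w \<theta> x * w \<theta> y))" if "\<theta> \<in> signs I" for \<theta> x
    using integrable_mult_right[OF gw_int[OF that], of "w \<theta> x"] by (simp add: mult.left_commute)
  have Ew: "?E0 (\<lambda>\<theta>. w \<theta> x) = 1" for x
    using sign_expect_tilt[of I "\<lambda>i. p i x" "\<lambda>_. 1"] finite_I by (simp add: w_def sign_expect_const)
  have g_int: "(\<integral>x. g x \<partial>N) = e0" "integrable N g"
    using bounded_integrable[of g 1] g01 by (auto simp: g_def e0_def)
  have EW: "?E0 W = e0"
  proof -
    have "?E0 W = (\<integral>x. ?E0 (\<lambda>\<theta>. g x * w \<theta> x) \<partial>N)"
      unfolding W_def by (rule integral_sign_expect[symmetric]) (rule gw_int)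
    then show ?thesis by (simp add: sign_expect_cmult Ew g_int)
  qed

  \<comment> \<open>The bound \<open>tn \<ge> n / 4\<close> at both points gives the factor
    \<open>4 * s / n\<close> in \<open>Q\<close>.\<close>
  have pp: "g y * (\<Prod>i\<in>I. 1 + p i x * p i y) \<le> g y + Q * (g y * \<bar>\<Sum>i\<in>I. trunc B i x * trunc B i y\<bar>)"
    if x: "x \<in> E" for x y
  proof (cases "y \<in> E")
    case True
    have "(\<Prod>i\<in>I. 1 + p i x * p i y) \<le> 1 + exp s * \<bar>\<Sum>i\<in>I. p i x * p i y\<bar>"
      using p1 p2[OF x] p2[OF True] by (intro tilt_correlation_le) auto
    also have "(\<Sum>i\<in>I. p i x * p i y) = s / (sqrt (tn x) * sqrt (tn y)) * (\<Sum>i\<in>I. trunc B i x * trunc B i y)"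
      unfolding sum_distrib_left
    proof (intro sum.cong refl)
      fix i
      have "p i x * p i y = (sqrt s * sqrt s) / (sqrt (tn x) * sqrt (tn y)) * (trunc B i x * trunc B i y)"
        using x True by (simp add: p_def)
      then show "p i x * p i y = s / (sqrt (tn x) * sqrt (tn y)) * (trunc B i x * trunc B i y)"
        using s0 by simp
    qed
    also have "exp s * \<bar>\<dots>\<bar> \<le> exp s * ((4 * s / n) * \<bar>\<Sum>i\<in>I. trunc B i x * trunc B i y\<bar>)"
    proof -
      have "sqrt (n / 4) * sqrt (n / 4) \<le> sqrt (tn x) * sqrt (tn y)"
        using tn_ge[OF x] tn_ge[OF True] n0 by (intro mult_mono) auto
      then have "n / 4 \<le> sqrt (tn x) * sqrt (tn y)" using n0 by simp
      moreover have pos: "tn x > 0" "tn y > 0" using tn_ge[OF x] tn_ge[OF True] n0 by auto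
      ultimately have "s / (sqrt (tn x) * sqrt (tn y)) \<le> s / (n / 4)"
        using s0 n0 by (intro divide_left_mono mult_pos_pos) auto
      then have "\<bar>s / (sqrt (tn x) * sqrt (tn y))\<bar> \<le> 4 * s / n" using s0 pos by (simp add: mult.commute)
      then show ?thesis unfolding abs_mult
        by (intro mult_left_mono mult_right_mono) auto
    qed
    finally show ?thesis using True by (simp add: g_def Q_def mult.assoc)
  qed (simp add: g_def)

  \<comment> \<open>Exchanging mean and integral turns \<open>w \<theta> x * w \<theta> y\<close>
    into the inner product of the densities at \<open>x\<close> and \<open>y\<close>.\<close>
  have inner: "?E0 (\<lambda>\<theta>. w \<theta> x * W \<theta>) \<le> e0 + Q * (B * T + (\<Sum>i\<in>I. \<bar>trunc B i x\<bar> * c i))" if x: "x \<in> E" for x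
  proof -
    let ?K = "\<lambda>y. \<bar>\<Sum>i\<in>I. trunc B i x * trunc B i y\<bar>"
    have "?E0 (\<lambda>\<theta>. w \<theta> x * W \<theta>) = ?E0 (\<lambda>\<theta>. \<integral>y. g y * (w \<theta> x * w \<theta> y) \<partial>N)"
      unfolding W_def by (simp add: mult.left_commute[of _ "w _ x"])
    also have "\<dots> = (\<integral>y. ?E0 (\<lambda>\<theta>. g y * (w \<theta> x * w \<theta> y)) \<partial>N)"
      by (rule integral_sign_expect[symmetric]) (rule gww_int)
    also have "\<dots> = (\<integral>y. g y * (\<Prod>i\<in>I. 1 + p i x * p i y) \<partial>N)"
      unfolding sign_expect_cmult w_def sign_expect_tilt_mult[OF finite_I] ..
    also have "\<dots> \<le> (\<integral>y. g y + Q * (g y * ?K y) \<partial>N)"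
    proof (rule integral_mono')
      have "integrable N (\<lambda>y. g y * ?K y)"
        unfolding g_def using trunc_integrable
        by (subst mult.commute) (intro integrable_real_mult_indicator E_meas integrable_abs
            Bochner_Integration.integrable_sum integrable_mult_right)
      then show "integrable N (\<lambda>y. g y + Q * (g y * ?K y))" using g_int by simp
      fix y
      have "0 \<le> Q" using s0 n0 by (simp add: Q_def)
      then show "0 \<le> g y + Q * (g y * ?K y)" using g01 by auto
    qed (rule pp[OF x])
    also have "\<dots> = e0 + Q * (\<integral>y. g y * ?K y \<partial>N)"
    proof -
      have "integrable N (\<lambda>y. g y * ?K y)"
        unfolding g_def using trunc_integrable
        by (subst mult.commute) (intro integrable_real_mult_indicator E_meas integrable_abs
            Bochner_Integration.integrable_sum integrable_mult_right)
      then show ?thesis using g_int by simp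
    qed
    also have "\<dots> \<le> e0 + Q * (B * T + (\<Sum>i\<in>I. \<bar>trunc B i x\<bar> * c i))"
      unfolding g_def c_def using s0 n0 truncated_correlation_le[OF T E_meas B, of x]
      by (intro add_left_mono mult_left_mono) (auto simp: Q_def)
    finally show ?thesis .
  qed

  have T0: "T \<ge> 0"
  proof -
    obtain \<theta> where "\<theta> \<in> signs I" using ex_L1_norm_ge by blast
    then show ?thesis using T by (smt (verit) integral_nonneg_AE AE_I2 abs_ge_zero)
  qed
  have Q0: "Q \<ge> 0" using s0 n0 by (simp add: Q_def)
  have c0: "c i \<ge> 0" for i unfolding c_def tail_mean_def by (rule integral_nonneg_AE) auto

  have EWW: "?E0 (\<lambda>\<theta>. W \<theta> * W \<theta>) \<le> e0 * e0 + Q * (B * T + R / B)"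
  proof -
    have i: "integrable N (\<lambda>x. g x * w \<theta> x * W \<theta>)" if "\<theta> \<in> signs I" for \<theta>
      using gw_int[OF that] by simp
    have "?E0 (\<lambda>\<theta>. W \<theta> * W \<theta>) = ?E0 (\<lambda>\<theta>. \<integral>x. g x * w \<theta> x * W \<theta> \<partial>N)"
      by (simp add: W_def)
    also have "\<dots> = (\<integral>x. ?E0 (\<lambda>\<theta>. g x * w \<theta> x * W \<theta>) \<partial>N)"
      by (rule integral_sign_expect[symmetric]) (rule i)
    \<comment> \<open>Passing from \<open>trunc B i x\<close> to \<open>a i x\<close> lets the unit
      column norms integrate the last sum to \<open>\<Sum>i\<in>I. c i\<close>.\<close>
    also have "\<dots> \<le> (\<integral>x. e0 * g x + Q * (B * T + (\<Sum>i\<in>I. \<bar>a i x\<bar> * c i)) \<partial>N)"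
    proof (rule integral_mono)
      show "integrable N (\<lambda>x. ?E0 (\<lambda>\<theta>. g x * w \<theta> x * W \<theta>))"
        by (rule integrable_sign_expect) (rule i)
      show "integrable N (\<lambda>x. e0 * g x + Q * (B * T + (\<Sum>i\<in>I. \<bar>a i x\<bar> * c i)))"
        using g_int a_integrable by auto
      fix x
      show "?E0 (\<lambda>\<theta>. g x * w \<theta> x * W \<theta>) \<le> e0 * g x + Q * (B * T + (\<Sum>i\<in>I. \<bar>a i x\<bar> * c i))"
      proof (cases "x \<in> E")
        case True
        have "(\<Sum>i\<in>I. \<bar>trunc B i x\<bar> * c i) \<le> (\<Sum>i\<in>I. \<bar>a i x\<bar> * c i)"
          using abs_trunc_le(2) c0 by (intro sum_mono mult_right_mono) auto
        then have "Q * (B * T + (\<Sum>i\<in>I. \<bar>trunc B i x\<bar> * c i)) \<le> Q * (B * T + (\<Sum>i\<in>I. \<bar>a i x\<bar> * c i))"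
          using Q0 by (intro mult_left_mono) auto
        then show ?thesis using inner[OF True] True by (simp add: g_def)
      next
        case False
        have "0 \<le> Q * (B * T + (\<Sum>i\<in>I. \<bar>a i x\<bar> * c i))"
          using Q0 B T0 c0 by (intro mult_nonneg_nonneg add_nonneg_nonneg sum_nonneg) auto
        then show ?thesis using False finite_I by (simp add: g_def sign_expect_const)
      qed
    qed
    also have "\<dots> = e0 * e0 + Q * (B * T + (\<Sum>i\<in>I. c i))"
      using g_int a_integrable col by (simp add: Bochner_Integration.integral_sum prob_space)
    also have "(\<Sum>i\<in>I. c i) \<le> R / B"
      unfolding c_def using E_meas B R by (intro sum_tail_mean_le) (auto simp: E_def)
    finally show ?thesis using Q0 by (simp add: mult_left_mono)
  qed

  have EBad: "?E0 Bad \<le> b"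
  proof -
    have "?E0 Bad = (\<integral>x. ?E0 (\<lambda>\<theta>. g x * (w \<theta> x * bad \<theta> x)) \<partial>N)"
      unfolding Bad_def by (rule integral_sign_expect[symmetric]) (rule gwb_int)
    also have "\<dots> \<le> (\<integral>x. b \<partial>N)"
    proof (rule integral_mono)
      show "integrable N (\<lambda>x. ?E0 (\<lambda>\<theta>. g x * (w \<theta> x * bad \<theta> x)))"
        by (rule integrable_sign_expect) (rule gwb_int)
      fix x assume "x \<in> space N"
      show "?E0 (\<lambda>\<theta>. g x * (w \<theta> x * bad \<theta> x)) \<le> b"
      proof (cases "x \<in> E")
        case True
        have t0: "tn x > 0" using tn_ge[OF True] n0 by simp
        have m0: "m x > 0" using t0 s0 by (simp add: m_def)
        have "(\<Sum>i\<in>I. p i x * a i x) = (\<Sum>i\<in>I. sqrt s / sqrt (tn x) * (trunc B i x)\<^sup>2)"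
          using True by (intro sum.cong) (auto simp: p_def trunc_def power2_eq_square)
        also have "\<dots> = sqrt s / sqrt (tn x) * tn x" by (simp only: sum_distrib_left[symmetric] tn_def)
        also have "\<dots> = sqrt s * (tn x / sqrt (tn x))" by simp
        also have "\<dots> = m x" using t0 by (simp only: real_div_sqrt less_imp_le m_def)
        finally have pm: "(\<Sum>i\<in>I. p i x * a i x) = m x" .
        \<comment> \<open>The factor \<open>w \<theta> x\<close> changes uniform signs into the law
          tilted at \<open>x\<close>, under which \<open>A \<theta> x\<close> has mean
          \<open>m x\<close>.\<close>
        have "?E0 (\<lambda>\<theta>. g x * (w \<theta> x * bad \<theta> x)) = sign_expect I (\<lambda>i. p i x) (\<lambda>\<theta>. bad \<theta> x)"
          using True by (simp add: g_def w_def sign_expect_tilt[of I "\<lambda>i. p i x"])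
        also have "\<dots> \<le> 4 * R / (m x)\<^sup>2 + 1 / s"
          unfolding bad_def A_def
          using p1 s0 m0 pm p2[OF True] True finite_I
          by (intro tilted_large_deviation) (auto simp: E_def sqn_def)
        also have "\<dots> \<le> 4 * R / (k * n / 32) + 1 / s"
        proof -
          have "k * n / 32 = s * (n / 4)" by (simp add: s_def)
          also have "\<dots> \<le> s * tn x" using tn_ge[OF True] s0 by (intro mult_left_mono) auto
          also have "\<dots> = (m x)\<^sup>2" using s0 t0 by (simp add: m_def power_mult_distrib)
          finally show ?thesis using R k n0 m0
            by (intro add_right_mono divide_left_mono mult_pos_pos[of "real k * n / 32"]) auto
        qed
        also have "\<dots> = b" using k n0 by (simp add: b_def s_def field_simps)
        finally show ?thesis .
      next
        case False
        then show ?thesis using R n0 finite_I by (simp add: g_def sign_expect_const b_def)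
      qed
    qed auto
    finally show ?thesis by (simp add: prob_space)
  qed

  let ?G = "\<lambda>\<theta>. {x \<in> D. sqrt (k * n / 128) \<le> A \<theta> x}"
  have G_meas: "?G \<theta> \<in> sets N" for \<theta> using D by measurable
  have G_int: "integrable N (indicat_real (?G \<theta>))" for \<theta>
    using G_meas by (intro bounded_integrable[of _ 1]) (auto simp: indicator_def)
  have G_sub: "?G \<theta> \<inter> space N = ?G \<theta>" for \<theta>
    using sets.sets_into_space[OF D] by blast
  \<comment> \<open>Points of \<open>E\<close> outside the bad event lie in
    \<open>?G \<theta>\<close> and have density at most \<open>exp (2 * s)\<close>; the other points
    of \<open>E\<close> are charged to \<open>Bad\<close>.\<close>
  have W_le: "W \<theta> \<le> Bad \<theta> + exp (2 * s) * prob (?G \<theta>)" if t: "\<theta> \<in> signs I" for \<theta>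
  proof -
    have "W \<theta> \<le> (\<integral>x. g x * (w \<theta> x * bad \<theta> x) + exp (2 * s) * indicator (?G \<theta>) x \<partial>N)"
      unfolding W_def
    proof (rule integral_mono)
      show "integrable N (\<lambda>x. g x * (w \<theta> x * bad \<theta> x) + exp (2 * s) * indicator (?G \<theta>) x)"
        using gwb_int[OF t] G_int[of \<theta>]
        by (intro Bochner_Integration.integrable_add integrable_mult_right)
      fix x
      show "g x * w \<theta> x \<le> g x * (w \<theta> x * bad \<theta> x) + exp (2 * s) * indicator (?G \<theta>) x"
      proof (cases "x \<in> E \<and> bad \<theta> x = 0")
        case True
        then have xE: "x \<in> E" and good: "m x / 2 \<le> A \<theta> x" "(\<Sum>i\<in>I. \<theta> i * p i x) \<le> 2 * s"
          by (auto simp: bad_def split: if_splits)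
        have "sqrt (k * n / 128) = sqrt (s * (n / 4) / 4)" by (simp add: s_def)
        also have "\<dots> \<le> sqrt (s * tn x / 4)"
          using tn_ge[OF xE] s0 by (intro real_sqrt_le_mono divide_right_mono mult_left_mono) auto
        also have "\<dots> = m x / 2" by (simp add: m_def real_sqrt_mult real_sqrt_divide)
        finally have "x \<in> ?G \<theta>" using good xE by (auto simp: E_def)
        moreover have "w \<theta> x \<le> exp (2 * s)" using w_exp[OF t, of x] good(2)
          by (meson exp_le_cancel_iff order_trans)
        ultimately show ?thesis using xE True by (simp add: g_def)
      next
        case False
        then have "g x * w \<theta> x = g x * (w \<theta> x * bad \<theta> x)" by (auto simp: g_def bad_def)
        moreover have "0 \<le> exp (2 * s) * indicat_real (?G \<theta>) x" by simp
        ultimately show ?thesis by linarith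
      qed
    qed (rule gw_int[OF t])
    also have "\<dots> = Bad \<theta> + exp (2 * s) * prob (?G \<theta>)"
      unfolding Bad_def using gwb_int[OF t] G_int[of \<theta>] G_sub[of \<theta>]
      by (subst Bochner_Integration.integral_add) simp_all
    finally show ?thesis .
  qed

  \<comment> \<open>Since \<open>exp (1 / 4) / 2\<close> is below 1, the worst case is
    \<open>k = 4\<close>, with value \<open>exp 1 / 16 \<le> 3 / 16\<close>. Half of this is a
    quarter of the lower bound 3/8 for \<open>e0\<close>.\<close>
  have num: "exp (2 * s) * (1 / 2 ^ k / 2) \<le> e0 / 4"
  proof -
    have "exp (2 * s) / 2 ^ k = (exp (1 / 4) / 2) ^ k"
      by (simp add: power_divide exp_of_nat_mult[symmetric] s_def)
    also have "\<dots> \<le> (exp (1 / 4) / 2) ^ 4"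
    proof (rule power_decreasing[OF k])
      have "exp (1/4) ^ 4 \<le> (2::real) ^ 4"
        using exp_le by (simp add: exp_of_nat_mult[symmetric])
      then have "exp (1/4) \<le> (2::real)" by (rule power_le_imp_le_base[of _ 3, simplified]) auto
      then show "exp (1 / 4) / 2 \<le> (1::real)" by simp
    qed auto
    also have "\<dots> = exp 1 / 16" by (simp add: power_divide exp_of_nat_mult[symmetric])
    also have "\<dots> \<le> 3 / 16" using exp_le by simp
    finally have "exp (2 * s) / 2 ^ k \<le> 3 / 16" .
    then have "exp (2 * s) / 2 ^ k / 2 \<le> 3 / 16 / 2" by (rule divide_right_mono) simp
    also have "\<dots> \<le> e0 / 4" using E by (simp add: e0_def)
    finally show ?thesis by simp
  qed
  have e0: "3 / 8 \<le> e0" using E by (simp add: e0_def)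

  \<comment> \<open>Failure gives \<open>W \<theta> \<le> Bad \<theta> + e0 / 4\<close>, so
    \<open>Bad \<theta>\<close> is at least \<open>e0 / 4\<close>, hence 3/32, or
    \<open>e0 - W \<theta>\<close> is at least \<open>e0 / 2\<close>, hence 3/16. The weights 11 and
    29 lift either term to at least 1.\<close>
  have "?E0 (\<lambda>\<theta>. if prob (?G \<theta>) < 1 / 2 ^ k / 2 then 1 else 0) \<le> ?E0 (\<lambda>\<theta>. 29 * ((W \<theta> * W \<theta> - 2 * e0 * W \<theta>) + e0 * e0) + 11 * Bad \<theta>)"
  proof (rule sign_expect_mono)
    fix \<theta> assume t: "\<theta> \<in> signs I"
    have sq: "(W \<theta> * W \<theta> - 2 * e0 * W \<theta>) + e0 * e0 = (e0 - W \<theta>)\<^sup>2" by algebra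
    have Bad0: "Bad \<theta> \<ge> 0" unfolding Bad_def
      using g01 w_nonneg[OF t] bad01 by (intro integral_nonneg_AE) auto
    have "1 \<le> 29 * (e0 - W \<theta>)\<^sup>2 + 11 * Bad \<theta>" if "prob (?G \<theta>) < 1 / 2 ^ k / 2"
    proof -
      have "exp (2 * s) * prob (?G \<theta>) \<le> exp (2 * s) * (1 / 2 ^ k / 2)"
        using that by (intro mult_left_mono) auto
      then have le: "W \<theta> \<le> Bad \<theta> + e0 / 4" using W_le[OF t] num by linarith
      show ?thesis
      proof (cases "Bad \<theta> \<ge> e0 / 4")
        case True
        then show ?thesis using e0 zero_le_power2[of "e0 - W \<theta>"] by linarith
      next
        case False
        then have "3 / 16 \<le> e0 - W \<theta>" using le e0 by linarith
        then have "(3 / 16)\<^sup>2 \<le> (e0 - W \<theta>)\<^sup>2" by (intro power_mono) auto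
        then show ?thesis using Bad0 by (simp add: power2_eq_square)
      qed
    qed
    then show "(if prob (?G \<theta>) < 1 / 2 ^ k / 2 then 1 else 0) \<le> 29 * ((W \<theta> * W \<theta> - 2 * e0 * W \<theta>) + e0 * e0) + 11 * Bad \<theta>"
      unfolding sq using Bad0 by auto
  qed auto
  also have "\<dots> = 29 * ((?E0 (\<lambda>\<theta>. W \<theta> * W \<theta>) - 2 * e0 * ?E0 W) + e0 * e0) + 11 * ?E0 Bad"
    by (simp only: sign_expect_add sign_expect_diff sign_expect_cmult sign_expect_const[OF finite_I])
  also have "\<dots> \<le> 29 * (Q * (B * T + R / B)) + 11 * b"
    unfolding EW using EWW EBad by (intro add_mono mult_left_mono) auto
  finally show ?thesis by (simp add: Q_def b_def s_def)
qed

subsection \<open>All levels simultaneously\<close>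

text \<open>The two alternatives are the ways in which signs can be good at level \<open>k\<close>: a large total
  \<open>L\<^sub>1\<close> norm, or large values on a set of measure about \<open>2\<^sup>-\<^sup>j\<close> for some \<open>j \<le> k\<close>.\<close>
definition good_at :: "real \<Rightarrow> 'a set \<Rightarrow> ('i \<Rightarrow> real) \<Rightarrow> nat \<Rightarrow> bool" where
  "good_at c D \<theta> k \<longleftrightarrow> c * sqrt (n * k) \<le> (\<integral>x. \<bar>A \<theta> x\<bar> \<partial>N) \<or>
    (\<exists>j\<le>k. 1 / 2 ^ j / 2 \<le> prob {x \<in> D. c * sqrt (n * k) \<le> A \<theta> x})"

text \<open>Markov's inequality for \<open>sqrt (sqn x)\<close>, whose mean is \<open>M\<close>,
  removes at most 1/8 from \<open>D\<close>.\<close>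

lemma prob_sqn_le:
  assumes D: "D \<in> sets N" "1 / 2 \<le> prob D"
  shows "3 / 8 \<le> prob {x \<in> D. sqn x \<le> 64 * M\<^sup>2}"
proof -
  let ?H = "{x \<in> space N. 8 * M \<le> sqrt (sqn x)}"
  have "prob ?H \<le> M / (8 * M)"
  proof (subst (2) M_def, rule integral_Markov_inequality_measure[OF sqrt_sqn_integrable D(1)])
    show "AE x in N. 0 \<le> sqrt (sqn x)" by (auto simp: sqn_def sum_nonneg)
  qed (use M_pos in simp)
  then have h: "prob ?H \<le> 1 / 8" using M_pos by simp
  have H: "x \<in> ?H" if "x \<in> D" "\<not> sqn x \<le> 64 * M\<^sup>2" for x
  proof -
    have "8 * M = sqrt (64 * M\<^sup>2)" using M_pos by (simp add: real_sqrt_mult)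
    also have "\<dots> \<le> sqrt (sqn x)" using that by (intro real_sqrt_le_mono) auto
    finally show ?thesis using that sets.sets_into_space[OF D(1)] by auto
  qed
  have "prob D \<le> prob ({x \<in> D. sqn x \<le> 64 * M\<^sup>2} \<union> ?H)"
    using D(1) H by (intro finite_measure_mono) auto
  also have "\<dots> \<le> prob {x \<in> D. sqn x \<le> 64 * M\<^sup>2} + prob ?H"
    using D by (intro measure_Un_le; measurable)
  finally show ?thesis using h D by linarith
qed

text \<open>A union bound over levels: \<open>K2\<close> and \<open>K3\<close> supply the conditions
  of \<open>level_failure\<close> on the truncation height, and \<open>K4\<close> absorbs the
  variance terms of all levels together.\<close>

lemma ex_signs_good_large:
  assumes D: "D \<in> sets N" "1 / 2 \<le> prob D"
    and K1: "1 \<le> ln n" and K2: "512 * ln n \<le> n powr (1/4)" and K3: "ln n \<le> sqrt n"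
    and K4: "3727 * (ln n)\<^sup>2 * n powr (-1/8) * (ln n + 1) \<le> 1 / 64"
  shows "\<exists>\<theta>\<in>signs I. \<forall>k. real k \<le> ln n \<longrightarrow> good_at (1 / 8000) D \<theta> k"
proof (cases "\<exists>\<theta>\<in>signs I. sqrt (n * ln n) < (\<integral>x. \<bar>A \<theta> x\<bar> \<partial>N)")
  case True
  then obtain \<theta> where t: "\<theta> \<in> signs I" "sqrt (n * ln n) < (\<integral>x. \<bar>A \<theta> x\<bar> \<partial>N)" by blast
  have "good_at (1 / 8000) D \<theta> k" if "real k \<le> ln n" for k
  proof -
    have "1 / 8000 * sqrt (n * k) \<le> 1 * sqrt (n * ln n)"
      using that n_ge1 by (intro mult_mono real_sqrt_le_mono mult_left_mono) auto
    then show ?thesis using t by (simp add: good_at_def)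
  qed
  then show ?thesis using t by blast
next
  case False
  define K where "K = ln n"
  define T where "T = sqrt (n * K)"
  \<comment> \<open>At this height \<open>B * T\<close> and \<open>R / B\<close> are of order at
    most \<open>n powr (3/4) * K\<close>. With \<open>exp (k / 8) \<le> n powr (1/8)\<close> and the
    factor \<open>k / (2 * n)\<close>, the variance term decays like \<open>n powr (-1/8)\<close> up
    to logarithms.\<close>
  define B where "B = n powr (1/4)"
  define R where "R = 64 * M\<^sup>2"
  \<comment> \<open>Below \<open>z\<close> the norm \<open>M / 4\<close> alone reaches
    \<open>sqrt (n * k) / 8000\<close>. From \<open>z\<close> on, the mean of the bad part
    contributes at most 90200 / 4000000.\<close>
  define z where "z = 4000000 * M\<^sup>2 / n"
  define k1 where "k1 = nat \<lceil>z\<rceil>"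
  define \<alpha> where "\<alpha> = 3727 * K\<^sup>2 * n powr (-1/8)"
  let ?E0 = "sign_expect I (\<lambda>_. 0)"
  let ?Y = "\<lambda>\<theta>. \<integral>x. \<bar>A \<theta> x\<bar> \<partial>N"
  define fail :: "nat \<Rightarrow> ('i \<Rightarrow> real) \<Rightarrow> real" where
    "fail k \<theta> = (if prob {x \<in> D. sqrt (k * n / 128) \<le> A \<theta> x} < 1 / 2 ^ k / 2 then 1 else 0)" for k \<theta>
  have n0: "n > 0" using n_ge1 by simp
  have T: "?Y \<theta> \<le> T" if "\<theta> \<in> signs I" for \<theta>
    using False that by (force simp: T_def K_def)
  \<comment> \<open>No signs exceed the norm \<open>T\<close>, yet some reach
    \<open>9 / 16 * M\<close>; this caps \<open>R\<close> at order \<open>n * K\<close>.\<close>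
  have MT: "M \<le> 16 / 9 * T"
    using ex_L1_norm_ge T by fastforce
  have K: "K \<ge> 1" using K1 by (simp add: K_def)
  have "M\<^sup>2 \<le> (16 / 9 * T)\<^sup>2" using MT M_pos by (intro power_mono) auto
  also have "\<dots> = 256 / 81 * (n * K)" using n0 K by (simp add: T_def power_mult_distrib power_divide)
  also have "\<dots> \<le> 4 * (n * K)" using n0 K by (intro mult_right_mono) auto
  finally have R_le: "R \<le> 256 * (n * K)" unfolding R_def by linarith
  have nM: "n \<le> M\<^sup>2" using M_ge n0 by (simp add: real_le_rsqrt sqrt_le_D)
  have z_ge: "z \<ge> 4000000" using nM n0 by (simp add: z_def field_simps)
  have zk: "z \<le> k1" using z_ge by (simp add: k1_def)
  have B0: "B > 0" using n0 by (simp add: B_def)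
  have level: "?E0 (fail k) \<le> \<alpha> + 90200 / (4000000 * 2 ^ j)" if kz: "z * 2 ^ j \<le> k" and kK: "real k \<le> K" for k j
  proof -
    have "1 * z \<le> 2 ^ j * z" using z_ge by (intro mult_right_mono) auto
    then have k0: "real k \<ge> 4000000" using kz z_ge unfolding mult_1 mult.commute[of z] by linarith
    have "R / B \<le> 256 * (n * K) / B" using R_le B0 by (simp add: divide_right_mono)
    also have "\<dots> = 256 * K * (n powr 1 / n powr (1/4))" using n0 by (simp add: B_def)
    also have "\<dots> = 256 * K * n powr (3/4)" by (simp only: powr_diff[symmetric]) simp
    finally have RB: "R / B \<le> 256 * K * n powr (3/4)" .
    have BT: "B * T \<le> K * n powr (3/4)"
    proof -
      have "sqrt K \<le> K" using K by (simp add: real_le_lsqrt power2_eq_square)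
      then have "B * T \<le> n powr (1/4) * (sqrt n * K)"
        unfolding B_def T_def real_sqrt_mult using n0 by (intro mult_left_mono) auto
      also have "\<dots> = K * (n powr (1/4) * n powr (1/2))" using n0 by (simp add: powr_half_sqrt)
      also have "\<dots> = K * n powr (3/4)" by (simp add: powr_add[symmetric])
      finally show ?thesis .
    qed
    have "R / B \<le> 256 * (n * K) / B" using R_le B0 by (simp add: divide_right_mono)
    also have "\<dots> \<le> 256 * (n * K) / (512 * K)"
      using K2[folded K_def B_def] K n0 B0 by (intro divide_left_mono mult_nonneg_nonneg mult_pos_pos) auto
    also have "\<dots> = n / 2" using K by simp
    finally have RB2: "R / B \<le> n / 2" .
    have kB: "real k * B\<^sup>2 \<le> 2 * n"
    proof -
      have "B\<^sup>2 = sqrt n" using n0 by (simp add: B_def powr_power powr_half_sqrt)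
      moreover have "real k * sqrt n \<le> sqrt n * sqrt n"
        using kK K3 n0 by (intro mult_right_mono) (auto simp: K_def)
      ultimately show ?thesis using n0 by simp
    qed
    have "?E0 (fail k) \<le> 29 * (exp (k / 8) * (k / (2 * n)) * (B * T + R / B)) + 11 * ((128 * R / n + 8) / k)"
      unfolding fail_def using prob_sqn_le[OF D] k0 B0
      by (intro level_failure[OF T D(1) refl _ B0 RB2 kB]) (auto simp: R_def)
    \<comment> \<open>The constant 3727 rounds up \<open>29 * 257 / 2\<close>, where 257 adds the
      256 from \<open>R / B\<close> to the 1 from \<open>B * T\<close>.\<close>
    also have "29 * (exp (k / 8) * (k / (2 * n)) * (B * T + R / B)) \<le> \<alpha>"
    proof -
      have "exp (k / 8) \<le> exp (K / 8)" using kK by simp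
      also have "exp (K / 8) = n powr (1/8)" using n0 by (simp add: powr_def K_def)
      finally have e: "exp (k / 8) \<le> n powr (1/8)" .
      have "0 \<le> B * T + R / B" using B0 n0 K by (auto simp: T_def R_def)
      then have "exp (k / 8) * (k / (2 * n)) * (B * T + R / B) \<le> n powr (1/8) * (K / (2 * n)) * (257 * K * n powr (3/4))"
        using e kK n0 RB BT K by (intro mult_mono divide_right_mono) auto
      also have "\<dots> = 257 / 2 * K\<^sup>2 * (n powr (1/8) * n powr (3/4) / n powr 1)"
        using n0 by (simp add: power2_eq_square field_simps)
      also have "\<dots> = 257 / 2 * K\<^sup>2 * n powr (-1/8)"
        by (simp only: powr_add[symmetric] powr_diff[symmetric]) simp
      finally have "29 * (exp (k / 8) * (k / (2 * n)) * (B * T + R / B)) \<le> 29 * (257 / 2 * K\<^sup>2 * n powr (-1/8))"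
        by (intro mult_left_mono) auto
      also have "\<dots> = (29 * (257 / 2)) * (K\<^sup>2 * n powr (-1/8))" by (simp only: mult.assoc)
      also have "\<dots> \<le> 3727 * (K\<^sup>2 * n powr (-1/8))" by (intro mult_right_mono) auto
      finally show ?thesis by (simp add: \<alpha>_def)
    qed
    also have "11 * ((128 * R / n + 8) / k) \<le> 90200 / (4000000 * 2 ^ j)"
    proof -
      have zp: "z * 2 ^ j > 0" using z_ge by simp
      \<comment> \<open>Here 8200 is \<open>128 * 64 + 8\<close>, the 8 being absorbed through
        \<open>n \<le> M\<^sup>2\<close>.\<close>
      have "128 * R / n + 8 \<le> 8200 * (M\<^sup>2 / n)"
        using nM n0 by (simp add: R_def field_simps)
      also have "\<dots> = 8200 / 4000000 * z" by (simp add: z_def)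
      finally have "11 * ((128 * R / n + 8) / k) \<le> 11 * ((8200 / 4000000 * z) / (z * 2 ^ j))"
        using kz zp n0 z_ge by (intro mult_left_mono frac_le) (auto simp: R_def)
      also have "\<dots> = 90200 / (4000000 * 2 ^ j)" using z_ge by simp
      finally show ?thesis .
    qed
    finally show ?thesis by simp
  qed
  \<comment> \<open>Only the levels \<open>k1 * 2 ^ j\<close> are tested: their bad parts decay
    geometrically, and there are at most \<open>K + 1\<close> of them to collect the variance
    term.\<close>
  define J where "J = {j::nat. real (k1 * 2 ^ j) \<le> K}"
  have "J \<subseteq> {..<nat \<lceil>K\<rceil>}"
  proof
    fix j assume "j \<in> J"
    then have "real (k1 * 2 ^ j) \<le> K" by (simp add: J_def)
    moreover have "k1 \<ge> 1" using zk z_ge by simp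
    then have "j < k1 * 2 ^ j" using less_exp[of j] by (metis le_trans less_le_trans mult_le_mono1 nat_mult_1)
    then have "real j < real (k1 * 2 ^ j)" by linarith
    ultimately have "real j < K" by linarith
    then show "j \<in> {..<nat \<lceil>K\<rceil>}" by (simp add: less_ceiling_iff zless_nat_eq_int_zless)
  qed
  then have finJ: "finite J" and "card J \<le> nat \<lceil>K\<rceil>"
    using finite_subset card_mono[of "{..<nat \<lceil>K\<rceil>}" J] by auto
  then have cardJ: "real (card J) \<le> K + 1" using K by linarith
  \<comment> \<open>The failure probabilities add up to at most 1/64 + 2 * 90200 / 4000000, about
    0.061, which is less than the chance 3/32 of a norm of at least \<open>M / 4\<close>.\<close>
  have "\<exists>\<theta>\<in>signs I. M / 4 \<le> ?Y \<theta> \<and> (\<forall>j\<in>J. fail (k1 * 2 ^ j) \<theta> = 0)"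
  proof (rule ccontr)
    assume *: "\<not> ?thesis"
    have fail0: "fail k \<theta> \<ge> 0" for k \<theta> by (simp add: fail_def)
    have "3 / 32 \<le> ?E0 (\<lambda>\<theta>. if M / 4 \<le> ?Y \<theta> then 1 else 0)" by (rule prob_L1_norm_ge)
    also have "\<dots> \<le> ?E0 (\<lambda>\<theta>. \<Sum>j\<in>J. fail (k1 * 2 ^ j) \<theta>)"
    proof (rule sign_expect_mono)
      fix \<theta> assume t: "\<theta> \<in> signs I"
      show "(if M / 4 \<le> ?Y \<theta> then 1 else 0) \<le> (\<Sum>j\<in>J. fail (k1 * 2 ^ j) \<theta>)"
      proof (cases "M / 4 \<le> ?Y \<theta>")
        case True
        then obtain j where j: "j \<in> J" "fail (k1 * 2 ^ j) \<theta> \<noteq> 0" using * t by blast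
        then have "fail (k1 * 2 ^ j) \<theta> = 1" by (simp add: fail_def split: if_splits)
        then have "1 \<le> (\<Sum>j\<in>J. fail (k1 * 2 ^ j) \<theta>)"
          using member_le_sum[OF j(1), of "\<lambda>j. fail (k1 * 2 ^ j) \<theta>"] fail0 finJ by simp
        then show ?thesis by simp
      qed (simp add: sum_nonneg fail0)
    qed auto
    also have "\<dots> = (\<Sum>j\<in>J. ?E0 (fail (k1 * 2 ^ j)))" by (rule sign_expect_sum)
    also have "\<dots> \<le> (\<Sum>j\<in>J. \<alpha> + 90200 / 4000000 * (1 / 2) ^ j)"
    proof (rule sum_mono)
      fix j assume "j \<in> J"
      moreover have "z * 2 ^ j \<le> real (k1 * 2 ^ j)" using zk by simp
      ultimately have "?E0 (fail (k1 * 2 ^ j)) \<le> \<alpha> + 90200 / (4000000 * 2 ^ j)"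
        by (intro level) (auto simp: J_def)
      then show "?E0 (fail (k1 * 2 ^ j)) \<le> \<alpha> + 90200 / 4000000 * (1 / 2) ^ j"
        by (simp add: power_one_over)
    qed
    also have "\<dots> = card J * \<alpha> + 90200 / 4000000 * (\<Sum>j\<in>J. (1 / 2) ^ j)"
      by (simp add: sum.distrib sum_distrib_left)
    also have "\<dots> \<le> (K + 1) * \<alpha> + 90200 / 4000000 * 2"
    proof (intro add_mono mult_mono)
      have "(\<Sum>j\<in>J. (1 / 2 :: real) ^ j) \<le> (\<Sum>j. (1 / 2) ^ j)"
        by (rule sum_le_suminf) (auto simp: finJ summable_geometric)
      then show "(\<Sum>j\<in>J. (1 / 2 :: real) ^ j) \<le> 2" by (simp add: suminf_geometric)
    qed (use cardJ K in \<open>auto simp: \<alpha>_def intro!: sum_nonneg\<close>)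
    also have "(K + 1) * \<alpha> \<le> 1 / 64" using K4 by (simp add: \<alpha>_def K_def mult_ac)
    finally show False by simp
  qed
  then obtain \<theta> where t: "\<theta> \<in> signs I" "M / 4 \<le> ?Y \<theta>" "\<And>j. j \<in> J \<Longrightarrow> fail (k1 * 2 ^ j) \<theta> = 0"
    by blast
  have "good_at (1 / 8000) D \<theta> k" if kK: "real k \<le> K" for k
  proof (cases "k < k1")
    case True
    then have "real k < z" by (simp add: k1_def zless_nat_eq_int_zless less_ceiling_iff)
    then have "n * k \<le> (2000 * M)\<^sup>2" using n0 by (simp add: z_def field_simps)
    then have "sqrt (n * k) \<le> 2000 * M" using M_pos by (simp add: real_le_lsqrt)
    then show ?thesis using t(2) by (simp add: good_at_def)
  next
    case False
    have k1pos: "k1 \<ge> 1" using zk z_ge by simp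
    \<comment> \<open>With \<open>j0 = Suc j\<close>, the level \<open>k\<close> lies between
      \<open>k1 * 2 ^ j\<close> and its double. Success at the left end serves \<open>k\<close> at
      the cost of a factor \<open>sqrt 2\<close> in the height.\<close>
    define j0 where "j0 = (LEAST j. k < k1 * 2 ^ j)"
    have ex: "k < k1 * 2 ^ k" using less_exp[of k] k1pos by (metis le_trans less_le_trans mult_le_mono1 nat_mult_1)
    then have j0: "k < k1 * 2 ^ j0" unfolding j0_def by (rule LeastI)
    then have "j0 \<noteq> 0" using False by (cases j0) auto
    then obtain j where j: "j0 = Suc j" using not0_implies_Suc by blast
    then have jk: "k1 * 2 ^ j \<le> k" using not_less_Least[of j "\<lambda>j. k < k1 * 2 ^ j"] unfolding j0_def by simp
    have "real (k1 * 2 ^ j) \<le> real k" using jk by linarith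
    then have "j \<in> J" using kK unfolding J_def mem_Collect_eq by linarith
    define k' where "k' = k1 * 2 ^ j"
    have p: "1 / 2 ^ k' / 2 \<le> prob {x \<in> D. sqrt (k' * n / 128) \<le> A \<theta> x}"
      using t(3)[OF \<open>j \<in> J\<close>] unfolding k'_def fail_def by (simp split: if_splits)
    have "k < 2 * k'" using j0 by (simp add: j k'_def)
    then have "real k \<le> 2 * real k'" by linarith
    then have "n * k \<le> n * (2 * k')" using n0 by (intro mult_left_mono) auto
    then have "sqrt (n * k / 256) \<le> sqrt (k' * n / 128)" by (intro real_sqrt_le_mono) (simp add: mult_ac)
    moreover have "sqrt (n * k / 256) = sqrt (n * k) / 16" by (simp add: real_sqrt_divide)
    moreover have "0 \<le> sqrt (n * k)" using n0 by simp
    ultimately have le: "1 / 8000 * sqrt (n * k) \<le> sqrt (k' * n / 128)" by linarith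
    have "prob {x \<in> D. sqrt (k' * n / 128) \<le> A \<theta> x} \<le> prob {x \<in> D. 1 / 8000 * sqrt (n * k) \<le> A \<theta> x}"
      using le D(1) by (intro finite_measure_mono) (auto intro: order_trans)
    then have "1 / 2 ^ k' / 2 \<le> prob {x \<in> D. 1 / 8000 * sqrt (n * k) \<le> A \<theta> x}" using p by linarith
    then show ?thesis using jk unfolding good_at_def k'_def[symmetric] by blast
  qed
  then show ?thesis using t(1) unfolding K_def by blast
qed

text \<open>For bounded \<open>n\<close> all levels are at most \<open>ln N0\<close>, so signs of
  norm at least \<open>9 / 16 * M\<close>, which exceeds \<open>sqrt n / 2\<close>, serve them
  all.\<close>

lemma ex_signs_good_small:
  assumes "n \<le> N0" "N0 \<ge> 3"
  shows "\<exists>\<theta>\<in>signs I. \<forall>k. real k \<le> ln n \<longrightarrow> good_at (1 / (2 * sqrt (ln N0))) D \<theta> k"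
proof -
  obtain \<theta> where t: "\<theta> \<in> signs I" "9 / 16 * M \<le> (\<integral>x. \<bar>A \<theta> x\<bar> \<partial>N)" using ex_L1_norm_ge by blast
  have l0: "ln N0 > 0" using assms by simp
  have "good_at (1 / (2 * sqrt (ln N0))) D \<theta> k" if "real k \<le> ln n" for k
  proof -
    have "ln n \<le> ln N0" using assms n_ge1 by simp
    then have "sqrt (n * k) \<le> sqrt n * sqrt (ln N0)"
      using that n_ge1 unfolding real_sqrt_mult by (intro mult_left_mono) auto
    then have "1 / (2 * sqrt (ln N0)) * sqrt (n * k) \<le> 1 / (2 * sqrt (ln N0)) * (sqrt n * sqrt (ln N0))"
      using l0 by (intro mult_left_mono) auto
    also have "\<dots> = 1 / 2 * sqrt n" using l0 by simp
    also have "\<dots> \<le> 9 / 16 * M" using M_ge M_pos by simp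
    also note t(2)
    finally show ?thesis by (simp add: good_at_def)
  qed
  then show ?thesis using t(1) by blast
qed

lemma good_at_mono:
  assumes "good_at c D \<theta> k" "c' \<le> c" "D \<in> sets N"
  shows "good_at c' D \<theta> k"
proof -
  have le: "c' * sqrt (n * k) \<le> c * sqrt (n * k)"
    using assms n_ge1 by (intro mult_right_mono) auto
  have "prob {x \<in> D. c * sqrt (n * k) \<le> A \<theta> x} \<le> prob {x \<in> D. c' * sqrt (n * k) \<le> A \<theta> x}"
    using le assms(3) by (intro finite_measure_mono) (auto intro: order_trans)
  then show ?thesis
    using assms(1) le unfolding good_at_def by (meson order_trans)
qed

end

text \<open>The threshold between small and large \<open>n\<close> comes from growth rates alone, so
  the smaller of the two constants serves every system.\<close>

lemma ex_uniform_constant: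
  "\<exists>c>0. \<forall>(N :: 'a measure) (I :: 'i set) a D. sign_system N I a \<longrightarrow> D \<in> sets N \<longrightarrow> 1 / 2 \<le> measure N D \<longrightarrow>
    (\<exists>\<theta>\<in>signs I. \<forall>k. real k \<le> ln (card I) \<longrightarrow> sign_system.good_at N I a c D \<theta> k)"
proof -
  have "eventually (\<lambda>n::real. 1 \<le> ln n \<and> 512 * ln n \<le> n powr (1/4) \<and> ln n \<le> sqrt n \<and>
      3727 * (ln n)\<^sup>2 * n powr (-1/8) * (ln n + 1) \<le> 1 / 64) at_top"
    by (intro eventually_conj; real_asymp)
  then obtain N1 where N1: "\<And>n::real. n \<ge> N1 \<Longrightarrow> 1 \<le> ln n \<and> 512 * ln n \<le> n powr (1/4) \<and> ln n \<le> sqrt n \<and>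
      3727 * (ln n)\<^sup>2 * n powr (-1/8) * (ln n + 1) \<le> 1 / 64"
    unfolding eventually_at_top_linorder by blast
  \<comment> \<open>The lower bound 3 keeps \<open>ln N0\<close> positive.\<close>
  define N0 where "N0 = max N1 3"
  define c where "c = min (1 / 8000) (1 / (2 * sqrt (ln N0)))"
  have "c > 0" by (simp add: c_def N0_def)
  moreover have "\<exists>\<theta>\<in>signs I. \<forall>k. real k \<le> ln (card I) \<longrightarrow> sign_system.good_at N I a c D \<theta> k"
    if "sign_system N I a" and D: "D \<in> sets N" "1 / 2 \<le> measure N D" for N :: "'a measure" and I :: "'i set" and a D
  proof -
    interpret sign_system N I a by fact
    show ?thesis
    proof (cases "n \<ge> N0")
      case True
      then have "n \<ge> N1" by (simp add: N0_def)
      then obtain \<theta> where t: "\<theta> \<in> signs I" "\<And>k. real k \<le> ln n \<Longrightarrow> good_at (1 / 8000) D \<theta> k"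
        using ex_signs_good_large[OF D] N1[of n] by blast
      have "good_at c D \<theta> k" if "real k \<le> ln n" for k
        by (rule good_at_mono[OF t(2)[OF that] _ D(1)]) (simp add: c_def)
      then show ?thesis using t(1) unfolding n_def by blast
    next
      case False
      then have "n \<le> N0" "N0 \<ge> 3" by (auto simp: N0_def)
      then obtain \<theta> where t: "\<theta> \<in> signs I" "\<And>k. real k \<le> ln n \<Longrightarrow> good_at (1 / (2 * sqrt (ln N0))) D \<theta> k"
        using ex_signs_good_small[of N0 D] by blast
      have "good_at c D \<theta> k" if "real k \<le> ln n" for k
        by (rule good_at_mono[OF t(2)[OF that] _ D(1)]) (simp add: c_def)
      then show ?thesis using t(1) unfolding n_def by blast
    qed
  qed
  ultimately show ?thesis by blast
qed

subsection \<open>Back to Lebesgue measure\<close>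

interpretation mu: prob_space mu
  by (rule prob_spaceI) (simp add: emeasure_restrict_space)

text \<open>Moving the endpoint from \<open>u\<close> to \<open>v\<close> adds at most the measure
  of \<open>{u<..v}\<close>, so the function is 1-Lipschitz.\<close>

lemma measure_mu_initial_continuous:
  assumes G: "G \<in> sets mu"
  shows "continuous_on {0..1} (\<lambda>u. measure mu (G \<inter> {0..u}))"
proof -
  let ?h = "\<lambda>u. measure mu (G \<inter> {0..u})"
  have I: "G \<inter> {0..u} \<in> sets mu" for u :: real
    using G by (auto simp: sets_restrict_space_iff)
  have step: "?h u \<le> ?h v \<and> ?h v \<le> ?h u + (v - u)" if "0 \<le> u" "u \<le> v" "v \<le> 1" for u v
  proof
    show "?h u \<le> ?h v" using that I[of v] by (intro mu.finite_measure_mono) auto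
    have "{u<..v} \<in> sets lebesgue" by (rule sets_completionI_sets) simp
    then have uv: "{u<..v} \<in> sets mu" using that by (auto simp: sets_restrict_space_iff)
    have "?h v \<le> measure mu (G \<inter> {0..u} \<union> {u<..v})"
      using that I[of u] uv by (intro mu.finite_measure_mono sets.Un) auto
    also have "\<dots> \<le> ?h u + measure mu {u<..v}"
      using I[of u] uv by (rule measure_Un_le)
    also have "measure mu {u<..v} = v - u"
      using that by (subst measure_restrict_space) auto
    finally show "?h v \<le> ?h u + (v - u)" .
  qed
  have "dist (?h u) (?h v) \<le> 1 * dist u v" if "u \<in> {0..1}" "v \<in> {0..1}" for u v
    using step[of u v] step[of v u] that by (cases "u \<le> v") (auto simp: dist_real_def)
  then have "1-lipschitz_on {0..1} ?h" by (intro lipschitz_onI) auto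
  then show ?thesis by (rule lipschitz_on_continuous_on)
qed

text \<open>The intermediate value theorem for the measure of \<open>G \<inter> {0..u}\<close> as a
  function of \<open>u\<close>.\<close>

lemma ex_subset_measure_mu:
  assumes G: "G \<in> sets mu" and t: "0 \<le> t" "t \<le> measure mu G"
  obtains H where "H \<in> sets mu" "H \<subseteq> G" "measure mu H = t"
proof -
  have "measure mu (G \<inter> {0..0}) \<le> measure mu {0}"
    by (intro mu.finite_measure_mono) (auto simp: sets_restrict_space_iff)
  also have "measure mu {0} = 0" by (simp add: measure_restrict_space)
  finally have "measure mu (G \<inter> {0..0}) = 0" using measure_nonneg[of mu "G \<inter> {0..0}"] by linarith
  moreover have "G \<inter> {0..1} = G" using sets.sets_into_space[OF G] by auto
  ultimately obtain u where u: "0 \<le> u" "u \<le> 1" "measure mu (G \<inter> {0..u}) = t"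
    using IVT'[of "\<lambda>u. measure mu (G \<inter> {0..u})" 0 t 1] t measure_mu_initial_continuous[OF G] by auto
  then show ?thesis using G by (intro that[of "G \<inter> {0..u}"]) (auto simp: sets_restrict_space_iff)
qed

text \<open>The missing measure is taken from the complement of \<open>G\<close>.\<close>

lemma ex_superset_measure_mu:
  assumes G: "G \<in> sets mu" and t: "measure mu G \<le> t" "t \<le> 1"
  obtains H where "H \<in> sets mu" "G \<subseteq> H" "measure mu H = t"
proof -
  have "measure mu (space mu - G) = 1 - measure mu G" using G by (rule mu.prob_compl)
  then obtain H where H: "H \<in> sets mu" "H \<subseteq> space mu - G" "measure mu H = t - measure mu G"
    using ex_subset_measure_mu[of "space mu - G" "t - measure mu G"] G t by auto
  have "measure mu (G \<union> H) = t"
    using H G by (subst mu.finite_measure_Union) auto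
  then show ?thesis using G H by (intro that[of "G \<union> H"]) auto
qed

section \<open>Averages over sets of measure \<open>1 / 2 ^ k\<close>\<close>

lemma set_integrable_mu:
  "integrable mu (h :: real \<Rightarrow> real) \<Longrightarrow> D \<in> sets mu \<Longrightarrow> set_integrable mu D h"
  unfolding set_integrable_def by (rule integrable_mult_indicator)

text \<open>A single set witnesses that the supremum at level \<open>k\<close> is at least
  \<open>v\<close>. Unlike the supremum, a witness can be split and carried to higher
  levels.\<close>

definition avg_ge :: "(real \<Rightarrow> real) \<Rightarrow> real \<Rightarrow> nat \<Rightarrow> bool" where
  "avg_ge h v k \<longleftrightarrow> (\<exists>\<Delta>\<in>sets mu. measure mu \<Delta> = 1 / 2 ^ k \<and> v \<le> 2 ^ k * (LINT x:\<Delta>|mu. h x))"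

text \<open>Cut the witness into two sets of equal measure: its average is the mean of their
  averages, so one of them does at least as well.\<close>

lemma avg_ge_Suc:
  assumes h: "integrable mu h" and "avg_ge h v k"
  shows "avg_ge h v (Suc k)"
proof -
  obtain D where D: "D \<in> sets mu" "measure mu D = 1 / 2 ^ k" "v \<le> 2 ^ k * (LINT x:D|mu. h x)"
    using assms unfolding avg_ge_def by blast
  obtain H where H: "H \<in> sets mu" "H \<subseteq> D" "measure mu H = 1 / 2 ^ Suc k"
    using ex_subset_measure_mu[of D "1 / 2 ^ Suc k"] D by (auto simp: field_simps)
  have DH: "D - H \<in> sets mu" "measure mu (D - H) = 1 / 2 ^ Suc k"
    using D H by (auto simp: mu.finite_measure_Diff field_simps)
  have "(LINT x:D|mu. h x) = (LINT x:H|mu. h x) + (LINT x:D - H|mu. h x)"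
    using set_integral_Un[of H "D - H" mu h] set_integrable_mu[OF h] H DH by (simp add: Un_absorb1)
  moreover have "v \<le> 2 ^ k * (LINT x:D|mu. h x)" by fact
  ultimately have "2 * v \<le> 2 ^ Suc k * (LINT x:H|mu. h x) + 2 ^ Suc k * (LINT x:D - H|mu. h x)"
    by (simp add: algebra_simps)
  then have "v \<le> 2 ^ Suc k * (LINT x:H|mu. h x) \<or> v \<le> 2 ^ Suc k * (LINT x:D - H|mu. h x)"
    by linarith
  then show ?thesis using H DH unfolding avg_ge_def by blast
qed

lemma avg_ge_mono: "integrable mu h \<Longrightarrow> avg_ge h v j \<Longrightarrow> j \<le> k \<Longrightarrow> avg_ge h v k"
  by (induction k) (auto simp: le_Suc_eq intro: avg_ge_Suc)

text \<open>At level 0 the whole interval has the integral as its average, and monotonicity in the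
  level does the rest.\<close>

lemma avg_ge_integral:
  assumes "integrable mu h"
  shows "avg_ge h (\<integral>x. h x \<partial>mu) k"
proof -
  have "(LINT x:space mu|mu. h x) = (\<integral>x. h x \<partial>mu)" by (rule set_integral_space[OF assms])
  then have "avg_ge h (\<integral>x. h x \<partial>mu) 0"
    using mu.prob_space unfolding avg_ge_def by (intro bexI[of _ "space mu"]) auto
  then show ?thesis using avg_ge_mono[OF assms] by blast
qed

text \<open>Nonnegativity bounds all averages by \<open>2 ^ k\<close> times the full integral. This
  boundedness is what lets a real supremum dominate the value at the witness.\<close>

lemma avg_ge_Sup:
  assumes h: "integrable mu h" "\<And>x. 0 \<le> h x" and "avg_ge h v k"
  shows "v \<le> (SUP \<Delta> \<in> {\<Delta> \<in> sets mu. measure mu \<Delta> = 1 / 2 ^ k}. 2 ^ k * (LINT x:\<Delta>|mu. h x))"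
proof -
  obtain D where D: "D \<in> sets mu" "measure mu D = 1 / 2 ^ k" "v \<le> 2 ^ k * (LINT x:D|mu. h x)"
    using assms unfolding avg_ge_def by blast
  have "(LINT x:H|mu. h x) \<le> (\<integral>x. h x \<partial>mu)" if "H \<in> sets mu" for H
    unfolding set_lebesgue_integral_def
    using h integrable_mult_indicator[OF that h(1)]
    by (intro integral_mono) (auto simp: indicator_def)
  then have "bdd_above ((\<lambda>\<Delta>. 2 ^ k * (LINT x:\<Delta>|mu. h x)) ` {\<Delta> \<in> sets mu. measure mu \<Delta> = 1 / 2 ^ k})"
    by (intro bdd_aboveI[of _ "2 ^ k * (\<integral>x. h x \<partial>mu)"]) auto
  then show ?thesis using D by (intro cSUP_upper2[of _ _ D]) auto
qed

text \<open>The density \<open>\<phi>\<close> carries the total size of the functions, so that the quotients \<open>a\<close> have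
  constant \<open>\<ell>\<^sub>1\<close> norm at every point.  The value 1 on the null set of \<open>N\<close> where \<open>\<phi> = 0\<close> keeps this true.\<close>
lemma normalized_sign_system:
  fixes f :: "'i \<Rightarrow> real \<Rightarrow> real"
  assumes I: "finite I" "I \<noteq> {}" and f: "\<And>i. i \<in> I \<Longrightarrow> integrable mu (f i)" "\<And>i. i \<in> I \<Longrightarrow> (\<integral>x. \<bar>f i x\<bar> \<partial>mu) = 1"
  defines "\<phi> \<equiv> \<lambda>x. (\<Sum>i\<in>I. \<bar>f i x\<bar>) / card I"
  defines "a \<equiv> \<lambda>i x. if \<phi> x = 0 then 1 else f i x / \<phi> x"
  defines "N \<equiv> density mu (\<lambda>x. ennreal (\<phi> x))"
  shows "sign_system N I a" and "\<And>i x. i \<in> I \<Longrightarrow> f i x = \<phi> x * a i x"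
    and "integrable mu \<phi>" "\<And>x. 0 \<le> \<phi> x" "(\<integral>x. \<phi> x \<partial>mu) = 1"
proof -
  have n0: "real (card I) > 0" using I by (simp add: card_gt_0_iff)
  show phi_int: "integrable mu \<phi>" unfolding \<phi>_def using f by auto
  show phi0: "0 \<le> \<phi> x" for x unfolding \<phi>_def by (auto intro!: divide_nonneg_nonneg sum_nonneg)
  show phi1: "(\<integral>x. \<phi> x \<partial>mu) = 1"
    unfolding \<phi>_def using f n0 by (simp add: Bochner_Integration.integral_sum)
  show fa: "f i x = \<phi> x * a i x" if "i \<in> I" for i x
  proof (cases "\<phi> x = 0")
    case True
    \<comment> \<open>Where \<open>\<phi>\<close> vanishes, so does every \<open>f i\<close>, which
      makes the default value of \<open>a\<close> harmless.\<close>
    then have "(\<Sum>i\<in>I. \<bar>f i x\<bar>) = 0" using n0 by (simp add: \<phi>_def)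
    then have "f i x = 0" using I that by (subst (asm) sum_nonneg_eq_0_iff) auto
    then show ?thesis using True by simp
  qed (simp add: a_def)
  have [measurable]: "\<phi> \<in> borel_measurable mu" using phi_int by simp
  have [measurable]: "f i \<in> borel_measurable mu" if "i \<in> I" for i using f(1)[OF that] by simp
  have a_meas [measurable]: "a i \<in> borel_measurable mu" if "i \<in> I" for i
    unfolding a_def using that by measurable
  have "prob_space N"
  proof (rule prob_spaceI)
    have "emeasure N (space N) = (\<integral>\<^sup>+x. ennreal (\<phi> x) \<partial>mu)"
      unfolding N_def by (subst emeasure_density) (auto intro!: nn_integral_cong simp: indicator_def)
    also have "\<dots> = 1" using phi0 phi1 by (subst nn_integral_eq_integral[OF phi_int]) auto
    finally show "emeasure N (space N) = 1" .
  qed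
  then interpret N: prob_space N .
  show "sign_system N I a"
  proof
    show "a i \<in> borel_measurable N" if "i \<in> I" for i
      using a_meas[OF that] by (simp add: N_def)
    show "(\<Sum>i\<in>I. \<bar>a i x\<bar>) = card I" for x
    proof (cases "\<phi> x = 0")
      case False
      then have "(\<Sum>i\<in>I. \<bar>a i x\<bar>) = (\<Sum>i\<in>I. \<bar>f i x\<bar>) / \<phi> x"
        using phi0[of x] by (simp add: a_def abs_divide sum_divide_distrib)
      then show ?thesis using False by (auto simp: \<phi>_def)
    qed (simp add: a_def)
    show "(\<integral>x. \<bar>a i x\<bar> \<partial>N) = 1" if "i \<in> I" for i
    proof -
      have "(\<integral>x. \<bar>a i x\<bar> \<partial>N) = (\<integral>x. \<phi> x * \<bar>a i x\<bar> \<partial>mu)"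
        unfolding N_def using a_meas[OF that] phi0 by (subst integral_real_density) auto
      also have "\<dots> = (\<integral>x. \<bar>f i x\<bar> \<partial>mu)"
        using fa[OF that] phi0 by (simp add: abs_mult)
      finally show ?thesis using f(2)[OF that] by simp
    qed
  qed (use I in auto)
qed

text \<open>Norms pass to Lebesgue measure unchanged because
  \<open>F = \<phi> * \<bar>A \<theta>\<bar>\<close>. Large values live on a set whose measure is
  known only under \<open>N\<close>, and adjusting this set to Lebesgue measure
  \<open>1 / 2 ^ j\<close> costs a factor 2 in the constant.\<close>

lemma ex_signs_avg_ge:
  "\<exists>c>0. \<forall>(I :: 'i set) f. finite I \<longrightarrow> I \<noteq> {} \<longrightarrow>
    (\<forall>i\<in>I. integrable mu (f i) \<and> (\<integral>x. \<bar>f i x\<bar> \<partial>mu) = 1) \<longrightarrow>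
    (\<exists>\<theta>\<in>signs I. \<forall>k. real k \<le> ln (card I) \<longrightarrow> avg_ge (\<lambda>x. \<bar>\<Sum>i\<in>I. \<theta> i * f i x\<bar>) (c * sqrt (real (card I) * real k)) k)"
proof -
  obtain c where c: "c > 0" and uniform: "\<And>(N :: real measure) (I :: 'i set) a D. sign_system N I a \<Longrightarrow> D \<in> sets N \<Longrightarrow>
      1 / 2 \<le> measure N D \<Longrightarrow> \<exists>\<theta>\<in>signs I. \<forall>k. real k \<le> ln (card I) \<longrightarrow> sign_system.good_at N I a c D \<theta> k"
    using ex_uniform_constant[where 'a=real and 'i='i] by blast
  have "\<exists>\<theta>\<in>signs I. \<forall>k. real k \<le> ln (card I) \<longrightarrow>
      avg_ge (\<lambda>x. \<bar>\<Sum>i\<in>I. \<theta> i * f i x\<bar>) (c / 2 * sqrt (real (card I) * real k)) k"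
    if I: "finite I" "I \<noteq> {}" and f: "\<forall>i\<in>I. integrable mu (f i) \<and> (\<integral>x. \<bar>f i x\<bar> \<partial>mu) = 1"
    for I :: "'i set" and f
  proof -
    define \<phi> where "\<phi> x = (\<Sum>i\<in>I. \<bar>f i x\<bar>) / card I" for x
    define a where "a i x = (if \<phi> x = 0 then 1 else f i x / \<phi> x)" for i x
    define N where "N = density mu (\<lambda>x. ennreal (\<phi> x))"
    \<comment> \<open>On \<open>D\<close> large values of \<open>A \<theta>\<close> remain large for
      \<open>F\<close>, and the complement of \<open>D\<close> has mass at most 1/2 under
      \<open>N\<close>.\<close>
    define D where "D = {x \<in> space mu. 1 / 2 \<le> \<phi> x}"
    have sys: "sign_system N I a" and fa: "\<And>i x. i \<in> I \<Longrightarrow> f i x = \<phi> x * a i x"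
      and phi: "integrable mu \<phi>" "\<And>x. 0 \<le> \<phi> x" "(\<integral>x. \<phi> x \<partial>mu) = 1"
      using normalized_sign_system[OF I, of f] f unfolding \<phi>_def a_def N_def by blast+
    interpret sign_system N I a by (rule sys)
    have [measurable]: "\<phi> \<in> borel_measurable mu" using phi(1) by simp
    have sets_N: "sets N = sets mu" by (simp add: N_def)
    have D: "D \<in> sets mu" unfolding D_def by measurable
    have prob_N: "prob G = (\<integral>x. \<phi> x * indicator G x \<partial>mu)" if "G \<in> sets mu" for G
    proof -
      have "prob G = (\<integral>x. indicator G x \<partial>N)"
        using that sets.sets_into_space[OF that] by (simp add: N_def Int_absorb2)
      also have "\<dots> = (\<integral>x. \<phi> x * indicator G x \<partial>mu)"
        unfolding N_def using that phi by (subst integral_real_density) auto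
      finally show ?thesis .
    qed
    have phi_ind: "integrable mu (\<lambda>x. \<phi> x * indicator G x)" if "G \<in> sets mu" for G
      using that phi(1) by (rule integrable_real_mult_indicator)
    have "1 / 2 \<le> prob D"
    proof -
      have "1 = (\<integral>x. \<phi> x \<partial>mu)" using phi by simp
      also have "\<dots> \<le> (\<integral>x. 1 / 2 + \<phi> x * indicator D x \<partial>mu)"
        using phi phi_ind[OF D] by (intro integral_mono) (auto simp: D_def indicator_def)
      also have "\<dots> = 1 / 2 + prob D"
        using phi_ind[OF D] prob_N[OF D] mu.prob_space by simp
      finally show ?thesis by simp
    qed
    then obtain \<theta> where \<theta>: "\<theta> \<in> signs I" "\<And>k. real k \<le> ln (card I) \<Longrightarrow> good_at c D \<theta> k"
      using uniform[OF sys, of D] D sets_N by blast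
    define F where "F x = \<bar>\<Sum>i\<in>I. \<theta> i * f i x\<bar>" for x
    have FA: "F x = \<phi> x * \<bar>A \<theta> x\<bar>" for x
    proof -
      have "(\<Sum>i\<in>I. \<theta> i * f i x) = \<phi> x * A \<theta> x"
        unfolding A_def sum_distrib_left using fa by (intro sum.cong) auto
      then show ?thesis using phi(2) by (simp add: F_def abs_mult)
    qed
    have F_int: "integrable mu F" unfolding F_def[abs_def] using f by auto
    have F0: "F x \<ge> 0" for x by (simp add: F_def)
    have "avg_ge F (c / 2 * sqrt (n * k)) k" if k: "real k \<le> ln (card I)" for k
    proof -
      define v where "v = c * sqrt (n * k)"
      have v0: "v \<ge> 0" using c n_ge1 by (simp add: v_def)
      have "avg_ge F (v / 2) k"
        using \<theta>(2)[OF k] unfolding good_at_def v_def[symmetric]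
      proof (elim disjE exE conjE)
        assume "v \<le> (\<integral>x. \<bar>A \<theta> x\<bar> \<partial>N)"
        also have "(\<integral>x. \<bar>A \<theta> x\<bar> \<partial>N) = (\<integral>x. \<phi> x * \<bar>A \<theta> x\<bar> \<partial>mu)"
          unfolding N_def using A_meas[of \<theta>] phi by (subst integral_real_density) (auto simp: N_def)
        finally have "v / 2 \<le> (\<integral>x. F x \<partial>mu)" unfolding FA using v0 by linarith
        then show ?thesis using avg_ge_integral[OF F_int, of k] unfolding avg_ge_def by force
      next
        fix j assume "j \<le> k" and p: "1 / 2 ^ j / 2 \<le> prob {x \<in> D. v \<le> A \<theta> x}"
        define G where "G = {x \<in> D. v \<le> A \<theta> x}"
        have G: "G \<in> sets mu"
          unfolding G_def sets_N[symmetric] using D A_meas[of \<theta>] unfolding sets_N[symmetric] by measurable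
        have vF: "v * \<phi> x \<le> F x" if "x \<in> G" for x
          using that phi(2)[of x] unfolding FA G_def by (subst mult.commute) (intro mult_left_mono, auto)
        have "avg_ge F (v / 2) j"
        \<comment> \<open>A set \<open>G\<close> that is too small is enlarged, since
          \<open>F \<ge> v * \<phi>\<close> on it already integrates to at least
          \<open>v * prob G\<close>. A set that is too large is shrunk, since
          \<open>F \<ge> v * \<phi> \<ge> v / 2\<close> holds at each of its points.\<close>
        proof (cases "measure mu G \<le> 1 / 2 ^ j")
          case True
          then obtain H where H: "H \<in> sets mu" "G \<subseteq> H" "measure mu H = 1 / 2 ^ j"
            using ex_superset_measure_mu[OF G, of "1 / 2 ^ j"] by auto
          have "v * (1 / 2 ^ j / 2) \<le> v * prob G" using p v0 unfolding G_def by (intro mult_left_mono)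
          also have "\<dots> = (\<integral>x. v * (\<phi> x * indicator G x) \<partial>mu)" by (simp add: prob_N[OF G])
          also have "\<dots> \<le> (LINT x:H|mu. F x)"
            unfolding set_lebesgue_integral_def
            using phi_ind[OF G] integrable_mult_indicator[OF H(1) F_int] vF F0 H(2)
            by (intro integral_mono) (auto simp: indicator_def)
          finally show ?thesis using H unfolding avg_ge_def by (auto simp: field_simps)
        next
          case False
          then obtain H where H: "H \<in> sets mu" "H \<subseteq> G" "measure mu H = 1 / 2 ^ j"
            using ex_subset_measure_mu[OF G, of "1 / 2 ^ j"] by auto
          have "v / 2 * (1 / 2 ^ j) = (\<integral>x. v / 2 * indicator H x \<partial>mu)"
            using H sets.sets_into_space[OF H(1)] by (simp add: Int_absorb2)
          also have "\<dots> \<le> (LINT x:H|mu. F x)"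
            unfolding set_lebesgue_integral_def
          proof (rule integral_mono)
            show "integrable mu (\<lambda>x. v / 2 * indicator H x)"
              using H(1) by (intro integrable_mult_right mu.integrable_const_bound[of _ 1]) (auto simp: indicator_def)
            show "integrable mu (\<lambda>x. indicator H x *\<^sub>R F x)"
              using H(1) F_int by (rule integrable_mult_indicator)
            fix x
            show "v / 2 * indicator H x \<le> indicator H x *\<^sub>R F x"
            proof (cases "x \<in> H")
              case True
              then have "x \<in> G" using H by blast
              then have "v * (1 / 2) \<le> v * \<phi> x" using v0 by (intro mult_left_mono) (auto simp: G_def D_def)
              then show ?thesis using vF[OF \<open>x \<in> G\<close>] True by simp
            qed simp
          qed
          finally show ?thesis using H unfolding avg_ge_def by (auto simp: field_simps)
        qed
        then show ?thesis using avg_ge_mono[OF F_int] \<open>j \<le> k\<close> by blast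
      qed
      then show ?thesis by (simp add: v_def)
    qed
    then show ?thesis using \<theta>(1) unfolding F_def n_def by blast
  qed
  then show ?thesis using c by (intro exI[of _ "c / 2"]) auto
qed

theorem theorem3:
  shows "\<exists>c0::real. c0 > 0 \<and>
    (\<forall>(n::nat) (f :: nat \<Rightarrow> real \<Rightarrow> real).
      n \<ge> 1 \<longrightarrow>
      (\<forall>i\<in>{1..n}. integrable mu (f i) \<and> (LINT x|mu. \<bar>f i x\<bar>) = 1) \<longrightarrow>
      (\<exists>\<theta> :: nat \<Rightarrow> real. (\<forall>i\<in>{1..n}. \<theta> i = 1 \<or> \<theta> i = -1) \<and>
        (\<forall>k::nat. 1 \<le> k \<and> int k \<le> \<lfloor>ln (real n)\<rfloor> \<longrightarrow>
          (SUP \<Delta> \<in> {\<Delta> \<in> sets mu. measure mu \<Delta> = 1 / 2 ^ k}.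
             2 ^ k * (LINT x:\<Delta>|mu. \<bar>\<Sum>i=1..n. \<theta> i * f i x\<bar>))
          \<ge> c0 * sqrt (real n * real k))))"
proof -
  obtain c where c: "c > 0" and main: "\<And>(I :: nat set) f. finite I \<Longrightarrow> I \<noteq> {} \<Longrightarrow>
      \<forall>i\<in>I. integrable mu (f i) \<and> (\<integral>x. \<bar>f i x\<bar> \<partial>mu) = 1 \<Longrightarrow>
      \<exists>\<theta>\<in>signs I. \<forall>k. real k \<le> ln (card I) \<longrightarrow>
        avg_ge (\<lambda>x. \<bar>\<Sum>i\<in>I. \<theta> i * f i x\<bar>) (c * sqrt (real (card I) * real k)) k"
    using ex_signs_avg_ge[where 'i=nat] by blast
  show ?thesis
  proof (intro exI[of _ c] conjI allI impI c)
    fix n :: nat and f :: "nat \<Rightarrow> real \<Rightarrow> real"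
    assume n: "n \<ge> 1" and f: "\<forall>i\<in>{1..n}. integrable mu (f i) \<and> (LINT x|mu. \<bar>f i x\<bar>) = 1"
    have ne: "{1..n} \<noteq> {}" using n by auto
    obtain \<theta> where \<theta>: "\<theta> \<in> signs {1..n}" and avg: "\<And>k. real k \<le> ln n \<Longrightarrow>
        avg_ge (\<lambda>x. \<bar>\<Sum>i=1..n. \<theta> i * f i x\<bar>) (c * sqrt (real n * real k)) k"
      using main[OF finite_atLeastAtMost ne f] by auto
    show "\<exists>\<theta> :: nat \<Rightarrow> real. (\<forall>i\<in>{1..n}. \<theta> i = 1 \<or> \<theta> i = -1) \<and>
        (\<forall>k::nat. 1 \<le> k \<and> int k \<le> \<lfloor>ln (real n)\<rfloor> \<longrightarrow>
          (SUP \<Delta> \<in> {\<Delta> \<in> sets mu. measure mu \<Delta> = 1 / 2 ^ k}.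
             2 ^ k * (LINT x:\<Delta>|mu. \<bar>\<Sum>i=1..n. \<theta> i * f i x\<bar>))
          \<ge> c * sqrt (real n * real k))"
    proof (intro exI[of _ \<theta>] conjI ballI allI impI)
      fix i assume "i \<in> {1..n}"
      then show "\<theta> i = 1 \<or> \<theta> i = -1" using signs_cases[OF \<theta>] by blast
    next
      fix k :: nat assume "1 \<le> k \<and> int k \<le> \<lfloor>ln (real n)\<rfloor>"
      then have "real k \<le> ln n" by (simp add: le_floor_iff)
      then show "(SUP \<Delta> \<in> {\<Delta> \<in> sets mu. measure mu \<Delta> = 1 / 2 ^ k}.
             2 ^ k * (LINT x:\<Delta>|mu. \<bar>\<Sum>i=1..n. \<theta> i * f i x\<bar>))
          \<ge> c * sqrt (real n * real k)"
        using f by (intro avg_ge_Sup avg integrable_abs Bochner_Integration.integrable_sum integrable_mult_right) auto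
    qed
  qed
qed

end
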